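(* For every convex body $C\subset\mathbb{R}^2$ there is a positive integer $m=m(C)$ such that every finite point set $P\subset\mathbb{R}^2$ can be colored with three colors in such a way that no translate of $C$ contains at least $m$ points of $P$, all of the same color; that is, for every translate $C'$ of $C$ with $|C'\cap P|\ge m$, the set $C'\cap P$ contains two points of different colors.
   Context: A (planar) convex body is a compact convex subset of $\mathbb{R}^2$ with non-empty interior. A translate of $C$ is a set $C+v=\{c+v: c\in C\}$ with $v\in\mathbb{R}^2$. *)

theory Defs
  imports "HOL-Analysis.Analysis"
begin

definition convex_body :: "'a::euclidean_space set \<Rightarrow> bool" where
  "convex_body C \<longleftrightarrow> convex C \<and> compact C \<and> interior C \<noteq> {}"

definition is_translate_of :: "'a::ab_group_add set \<Rightarrow> 'a set \<Rightarrow> bool" where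
  "is_translate_of C' C \<longleftrightarrow> (\<exists>v. C' = (\<lambda>c. c + v) ` C)"

end

theory Submission
  imports Defs "HOL-Library.Ramsey"
begin

text \<open>
  Cut the plane into cells so small that a translate \<open>C'\<close> of \<open>C\<close> meets a cell in the way \<open>C\<close> meets a small
  ball around one of finitely many boundary points \<open>p j\<close>. Each cell is coloured separately. The translates
  that look like \<open>C\<close> near \<open>p j\<close> form a family \<open>F j\<close>; any two of them cross at most once inside the cell, so
  their traces contain no pattern \<open>ABA\<close> along a suitable order of the points.

  Choose disjoint layers \<open>R i\<close>, each a minimal hitting set of \<open>F i\<close> on the points left over by the earlier
  layers, and give all remaining points the third colour. If every member of \<open>F i\<close> that meets \<open>R i\<close> has a point
  of \<open>R i\<close> in one of the first two colours, only sets that are large inside a single layer remain to be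
  considered. In a layer the families whose preorders are jointly complete are handled by boundedly many
  dominating points (two transitive relations that together compare all pairs have a common dominator).
  Minimality makes \<open>R i\<close> an antichain for \<open>F i\<close>, and a sign argument with the directions \<open>p k - p j\<close> shows that the
  families not handled this way split into those near \<open>p i\<close> and those far from \<open>p i\<close>; both groups are \<open>ABA\<close>-free
  with respect to the same linear order on \<open>R i\<close>, and two such families always admit a three-colouring.
\<close>

section \<open>Families without the pattern \<open>ABA\<close>\<close>

text \<open>The translates as a whole admit no linear order of the points that excludes the pattern.
  The remedy is the convex cone of directions in which every point of \<open>C\<close> near
  \<open>p i\<close> can be moved a little without leaving \<open>C\<close>. If \<open>y - x\<close>
  lies in this cone, every member of \<open>F i\<close> containing \<open>x\<close> contains
  \<open>y\<close>. On an antichain for \<open>F i\<close>, therefore, neither a difference of two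
  points nor its negative lies in the cone, and all nonzero vectors of the cone are on one side of
  each difference: they all sort the points alike. The cone contains the direction to the centre of
  an inball and the chords from \<open>p i\<close> to all points of \<open>C\<close> not too close
  to it, so its order also speaks about families at distant boundary points. If two of these distant
  points were far from each other too, each of three points would be a strict extreme of one linear
  functional; hence the distant families concentrate in one place.

  The third colour has two jobs, inside a layer and outside all layers. This is why a colour other
  than 2 is demanded in every member of \<open>F i\<close> that meets its own layer.\<close>

definition bichromatic :: "('a \<Rightarrow> nat) \<Rightarrow> 'a set \<Rightarrow> bool" where
  "bichromatic c A \<longleftrightarrow> (\<exists>x\<in>A. \<exists>y\<in>A. c x \<noteq> c y)"

lemma bichromatic_mono: "bichromatic c A \<Longrightarrow> A \<subseteq> B \<Longrightarrow> bichromatic c B"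
  unfolding bichromatic_def by blast

lemma bichromatic_cong: "(\<And>x. x \<in> A \<Longrightarrow> c x = c' x) \<Longrightarrow> bichromatic c A \<longleftrightarrow> bichromatic c' A"
  unfolding bichromatic_def by auto

definition ABA_free :: "('a \<Rightarrow> real) \<Rightarrow> 'a set \<Rightarrow> 'a set set \<Rightarrow> bool" where
  "ABA_free f W \<F> \<longleftrightarrow> (\<forall>X\<in>\<F>. \<forall>Y\<in>\<F>. \<forall>a\<in>W. \<forall>b\<in>W. \<forall>c\<in>W. f a < f b \<longrightarrow> f b < f c \<longrightarrow>
     a \<in> X \<longrightarrow> c \<in> X \<longrightarrow> b \<in> Y \<longrightarrow> a \<in> Y \<or> c \<in> Y \<or> b \<in> X)"

lemma ABA_freeD:
  "ABA_free f W \<F> \<Longrightarrow> X \<in> \<F> \<Longrightarrow> Y \<in> \<F> \<Longrightarrow> a \<in> W \<Longrightarrow> b \<in> W \<Longrightarrow> c \<in> W \<Longrightarrow> f a < f b \<Longrightarrow> f b < f c \<Longrightarrow>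
     a \<in> X \<Longrightarrow> c \<in> X \<Longrightarrow> b \<in> Y \<Longrightarrow> a \<in> Y \<or> c \<in> Y \<or> b \<in> X"
  unfolding ABA_free_def by blast

lemma ABA_free_mono:
  "ABA_free f W \<F> \<Longrightarrow> V \<subseteq> W \<Longrightarrow> \<G> \<subseteq> \<F> \<Longrightarrow> ABA_free f V \<G>"
  unfolding ABA_free_def by (meson subsetD)

section \<open>Points that no member jumps over\<close>

definition unskippable :: "('a \<Rightarrow> real) \<Rightarrow> 'a set \<Rightarrow> 'a set set \<Rightarrow> 'a set" where
  "unskippable f V \<F> = {v\<in>V. \<forall>X\<in>\<F>. \<forall>a\<in>X \<inter> V. \<forall>b\<in>X \<inter> V. f a < f v \<longrightarrow> f v < f b \<longrightarrow> v \<in> X}"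

lemma unskippableD:
  "v \<in> unskippable f V \<F> \<Longrightarrow> X \<in> \<F> \<Longrightarrow> a \<in> X \<Longrightarrow> a \<in> V \<Longrightarrow> b \<in> X \<Longrightarrow> b \<in> V \<Longrightarrow> f a < f v \<Longrightarrow> f v < f b \<Longrightarrow> v \<in> X"
  unfolding unskippable_def by blast

text \<open>If \<open>B\<close> skips \<open>u\<close> in \<open>V\<close> but nothing skips it
  after \<open>v\<close> is deleted, then \<open>v\<close> is one of the two points of
  \<open>B\<close> enclosing \<open>u\<close>. Let \<open>D\<close> skip \<open>v\<close> between
  \<open>x\<close> and \<open>w\<close>. Without the forbidden pattern one of \<open>x\<close> and
  \<open>w\<close> lies in \<open>B\<close>, and with its help \<open>B\<close> or \<open>D\<close>
  skips \<open>u\<close> without using \<open>v\<close>.\<close>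

lemma unskippable_delete:
  assumes aba: "ABA_free f V \<F>" and inj: "inj_on f V" and v: "v \<in> V" "v \<notin> unskippable f V \<F>"
  shows "unskippable f (V - {v}) \<F> \<subseteq> unskippable f V \<F>"
proof
  fix u assume u: "u \<in> unskippable f (V - {v}) \<F>"
  then have uV: "u \<in> V" "u \<noteq> v" by (auto simp: unskippable_def)
  obtain D x w where D: "D \<in> \<F>" "x \<in> D" "x \<in> V" "w \<in> D" "w \<in> V" "f x < f v" "f v < f w" "v \<notin> D"
    using v unfolding unskippable_def by blast
  have xv: "x \<noteq> v" "w \<noteq> v" using D by auto
  show "u \<in> unskippable f V \<F>"
  proof (rule ccontr)
    assume "u \<notin> unskippable f V \<F>"
    then obtain B a b where B: "B \<in> \<F>" "a \<in> B" "a \<in> V" "b \<in> B" "b \<in> V" "f a < f u" "f u < f b" "u \<notin> B"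
      using uV unfolding unskippable_def by blast
    note skip = unskippableD[OF u]
    have uD: "f w \<noteq> f u" if "u \<notin> D" using that D uV inj by (metis inj_onD)
    have uD': "f x \<noteq> f u" if "u \<notin> D" using that D uV inj by (metis inj_onD)
    consider "a \<noteq> v" "b \<noteq> v" | "a = v" "b \<noteq> v" | "a \<noteq> v" "b = v" using B by fastforce
    then show False
    proof cases
      case 1 then show ?thesis using skip[of B a b] B by blast
    next
      case 2
      have xB: "x \<notin> B" using skip[of B x b] B D xv 2 by auto
      have "u \<notin> D"
        using ABA_freeD[OF aba D(1) B(1), of x v u] D B uV xB 2 by auto
      moreover have "w \<notin> B \<Longrightarrow> False"
        using ABA_freeD[OF aba D(1) B(1), of x v w] D B uV xB 2 by auto
      ultimately show False
        using skip[of D x w] skip[of B w b] D B xv 2 uD by fastforce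
    next
      case 3
      have wB: "w \<notin> B" using skip[of B a w] B D xv 3 by auto
      have "u \<notin> D"
        using ABA_freeD[OF aba D(1) B(1), of u v w] D B uV wB 3 by auto
      moreover have "x \<notin> B \<Longrightarrow> False"
        using ABA_freeD[OF aba D(1) B(1), of x v w] D B uV wB 3 by auto
      ultimately show False
        using skip[of D x w] skip[of B a x] D B xv 3 uD' by fastforce
    qed
  qed
qed

text \<open>Skippable points are deleted one by one, and \<open>X\<close> never loses its last
  point: if \<open>X\<close> contains the skipped \<open>v\<close>, it also contains one of the two
  points enclosing \<open>v\<close>, since otherwise the three form the forbidden pattern.\<close>

lemma unskippable_hits:
  assumes "finite V" "ABA_free f V \<F>" "inj_on f V" "X \<in> \<F>" "X \<inter> V \<noteq> {}"
  shows "X \<inter> unskippable f V \<F> \<noteq> {}"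
  using assms
proof (induction "card V" arbitrary: V rule: less_induct)
  case less
  show ?case
  proof (cases "unskippable f V \<F> = V")
    case True then show ?thesis using less by auto
  next
    case False
    then obtain v where v: "v \<in> V" "v \<notin> unskippable f V \<F>" by (auto simp: unskippable_def)
    then obtain D x w where D: "D \<in> \<F>" "x \<in> D" "x \<in> V" "w \<in> D" "w \<in> V" "f x < f v" "f v < f w" "v \<notin> D"
      unfolding unskippable_def by blast
    have "X \<inter> (V - {v}) \<noteq> {}"
    proof (cases "v \<in> X")
      case True
      then have "x \<in> X \<or> w \<in> X"
        using ABA_freeD[OF less.prems(2) D(1) less.prems(4), of x v w] D v by auto
      then show ?thesis using D by auto
    next
      case False then show ?thesis using less.prems by auto
    qed
    moreover have "card (V - {v}) < card V" using v less.prems(1) by (meson card_Diff1_less)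
    ultimately have "X \<inter> unskippable f (V - {v}) \<F> \<noteq> {}"
      using less.hyps[of "V - {v}"] less.prems ABA_free_mono[OF less.prems(2), of "V - {v}" \<F>]
      by (auto intro: inj_on_diff)
    then show ?thesis using unskippable_delete[OF less.prems(2,3) v] by blast
  qed
qed

section \<open>Minimal hitting sets and colourings along a linear order\<close>

lemma minimal_hitting_set:
  assumes "finite H" "\<And>X. X \<in> \<F> \<Longrightarrow> X \<inter> H \<noteq> {}"
  shows "\<exists>R\<subseteq>H. (\<forall>X\<in>\<F>. X \<inter> R \<noteq> {}) \<and> (\<forall>r\<in>R. \<exists>X\<in>\<F>. X \<inter> R = {r})"
proof -
  let ?P = "\<lambda>R. R \<subseteq> H \<and> (\<forall>X\<in>\<F>. X \<inter> R \<noteq> {})"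
  have "?P H" using assms by auto
  then obtain R where R: "?P R" and min: "\<And>R'. ?P R' \<Longrightarrow> card R \<le> card R'"
    using ex_has_least_nat[of ?P H card] by blast
  have "\<exists>X\<in>\<F>. X \<inter> R = {r}" if "r \<in> R" for r
  proof -
    have "finite R" using R assms finite_subset by blast
    then have "card (R - {r}) < card R" using that by (meson card_Diff1_less)
    then have "\<not> ?P (R - {r})" using min[of "R - {r}"] by linarith
    then obtain X where "X \<in> \<F>" "X \<inter> (R - {r}) = {}" using R by blast
    moreover have "X \<inter> R \<noteq> {}" using R calculation by blast
    ultimately show ?thesis using that by blast
  qed
  then show ?thesis using R by blast
qed

definition contiguous :: "('a \<Rightarrow> real) \<Rightarrow> 'a set \<Rightarrow> 'a set \<Rightarrow> bool" where
  "contiguous f R X \<longleftrightarrow> (\<forall>a\<in>X \<inter> R. \<forall>b\<in>R. \<forall>c\<in>X \<inter> R. f a < f b \<longrightarrow> f b < f c \<longrightarrow> b \<in> X)"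

text \<open>The private set of a point \<open>b\<close> skipped by \<open>X\<close> would form the
  pattern with \<open>X\<close>.\<close>

lemma minimal_hitting_contiguous:
  assumes "ABA_free f V \<F>" "R \<subseteq> V" "\<And>r. r \<in> R \<Longrightarrow> \<exists>X\<in>\<F>. X \<inter> R = {r}" "X \<in> \<F>"
  shows "contiguous f R X"
  unfolding contiguous_def
proof (intro ballI impI)
  fix a b c assume h: "a \<in> X \<inter> R" "b \<in> R" "c \<in> X \<inter> R" "f a < f b" "f b < f c"
  obtain Y where "Y \<in> \<F>" "Y \<inter> R = {b}" using assms(3) h by blast
  moreover have "a \<in> V" "b \<in> V" "c \<in> V" "b \<in> Y" "a \<notin> Y" "c \<notin> Y"
    using h assms(2) calculation by auto
  ultimately show "b \<in> X" using ABA_freeD[OF assms(1,4), of Y a b c] h by auto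
qed

definition rank_parity :: "('a \<Rightarrow> real) \<Rightarrow> 'a set \<Rightarrow> 'a \<Rightarrow> nat" where
  "rank_parity f F x = card {y\<in>F. f y < f x} mod 2"

lemma rank_parity_bichromatic:
  assumes "finite F" "inj_on f F" "contiguous f F X" "card (X \<inter> F) \<ge> 2"
  shows "bichromatic (rank_parity f F) (X \<inter> F)"
proof -
  have fin: "finite (X \<inter> F)" using assms by auto
  have "\<not> card (X \<inter> F) \<le> Suc 0" using assms(4) by simp
  then obtain a b where ab: "a \<in> X \<inter> F" "b \<in> X \<inter> F" "a \<noteq> b"
    using card_le_Suc0_iff_eq[OF fin] by blast
  then have "f a \<noteq> f b" using assms(2) by (auto dest: inj_onD)
  then obtain a b where ab: "a \<in> X \<inter> F" "b \<in> X \<inter> F" "f a < f b"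
    using ab by (meson linorder_less_linear)
  let ?S = "{y\<in>F. f a < f y}"
  have S: "finite ?S" "?S \<noteq> {}" using assms(1) ab by auto
  \<comment> \<open>\<open>y\<close> is the immediate successor of \<open>a\<close> in
    \<open>F\<close>: contiguity puts it into \<open>X\<close>, and its rank exceeds that of
    \<open>a\<close> by one.\<close>
  define y where "y = arg_min_on f ?S"
  have y: "y \<in> F" "f a < f y" using arg_min_if_finite(1)[OF S, of f] unfolding y_def by auto
  have least: "f y \<le> f z" if "z \<in> F" "f a < f z" for z
    using arg_min_if_finite(2)[OF S, of f] that unfolding y_def by force
  have yX: "y \<in> X"
  proof (cases "y = b")
    case False
    then have "f y \<noteq> f b" using assms(2) y ab by (auto dest: inj_onD)
    then have "f y < f b" using least[of b] ab by auto
    then show ?thesis using assms(3) ab y unfolding contiguous_def by blast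
  qed (use ab in auto)
  have "z = a \<or> f z < f a" if "z \<in> F" "f z < f y" for z
  proof -
    have "\<not> f a < f z" using least[of z] that by auto
    then show ?thesis using inj_onD[OF assms(2), of z a] that ab by fastforce
  qed
  then have "{z\<in>F. f z < f y} = insert a {z\<in>F. f z < f a}"
    using y ab by auto
  then have "card {z\<in>F. f z < f y} = Suc (card {z\<in>F. f z < f a})" using assms(1) by simp
  then have "rank_parity f F y \<noteq> rank_parity f F a" unfolding rank_parity_def by presburger
  then show ?thesis using yX y ab unfolding bichromatic_def by blast
qed

text \<open>\<open>Y\<close> meets \<open>R\<close> only in \<open>r2\<close>, so it misses
  \<open>r1\<close> and \<open>r3\<close>; being unskippable, these cannot have points of
  \<open>Y\<close> on both sides.\<close>

lemma private_between:
  assumes "R \<subseteq> unskippable f V \<F>" "inj_on f V" "Y \<in> \<F>" "Y \<inter> R = {r2}"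
    "r1 \<in> R" "r2 \<in> R" "r3 \<in> R" "f r1 < f r2" "f r2 < f r3" "z \<in> Y" "z \<in> V"
  shows "f r1 < f z" "f z < f r3"
proof -
  have V: "r1 \<in> V" "r2 \<in> V" "r3 \<in> V" using assms unfolding unskippable_def by auto
  have n: "r1 \<notin> Y" "r3 \<notin> Y" "r2 \<in> Y" using assms by auto
  have "f z \<noteq> f r1" using inj_onD[OF assms(2), of z r1] assms(10,11) n V by blast
  moreover have "f z \<noteq> f r3" using inj_onD[OF assms(2), of z r3] assms(10,11) n V by blast
  moreover have "\<not> f z < f r1"
    using unskippableD[of r1 f V \<F> Y z r2] subsetD[OF assms(1,5)] assms(3,8,10,11) V n by blast
  moreover have "\<not> f r3 < f z"
    using unskippableD[of r3 f V \<F> Y r2 z] subsetD[OF assms(1,7)] assms(3,9,10,11) V n by blast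
  ultimately show "f r1 < f z" "f z < f r3" by auto
qed

lemma three_ordered:
  assumes "finite A" "inj_on f A" "card A \<ge> 3"
  shows "\<exists>a\<in>A. \<exists>b\<in>A. \<exists>c\<in>A. f a < f b \<and> f b < (f c :: real)"
proof -
  obtain T where T: "T \<subseteq> A" "card T = 3" using assms by (meson obtain_subset_with_card_n)
  then obtain x y z where xyz: "T = {x,y,z}" "x \<noteq> y" "y \<noteq> z" "x \<noteq> z" by (auto simp: card_3_iff)
  then have A: "x \<in> A" "y \<in> A" "z \<in> A" using T by auto
  then have "f x \<noteq> f y" "f y \<noteq> f z" "f x \<noteq> f z"
    using xyz inj_on_eq_iff[OF assms(2)] by simp_all
  then show ?thesis using A by (meson linorder_less_linear)
qed

text \<open>Choosing \<open>R\<close> among unskippable points keeps it sparse. If \<open>X\<close>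
  contains \<open>a\<close>, \<open>b\<close>, \<open>c\<close> of \<open>R\<close> in this order,
  the private set of \<open>b\<close> lies strictly between \<open>a\<close> and \<open>c\<close>,
  hence its points in \<open>V\<close> belong to \<open>X\<close>, by contiguity or by absence of
  the pattern; \<open>k - 1\<close> of them are outside \<open>R\<close>. With at most two points in
  \<open>R\<close>, a set of \<open>k + 1\<close> points has that many left anyway.\<close>

lemma sparse_hitting_set:
  assumes fin: "finite V" and inj: "inj_on f V" and aba: "ABA_free f V \<F>" and "k > 0"
  shows "\<exists>R\<subseteq>V. (\<forall>Y\<in>\<F>. card (Y \<inter> V) \<ge> k \<longrightarrow> Y \<inter> R \<noteq> {}) \<and>
    (\<forall>X. contiguous f V X \<longrightarrow> card (X \<inter> R) \<ge> 3 \<longrightarrow> card (X \<inter> (V - R)) \<ge> k - 1) \<and>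
    (\<forall>Y\<in>\<F>. card (Y \<inter> V) \<ge> k + 1 \<longrightarrow> card (Y \<inter> (V - R)) \<ge> k - 1)"
proof -
  let ?G = "{Y\<in>\<F>. card (Y \<inter> V) \<ge> k}"
  have abaG: "ABA_free f V ?G" using ABA_free_mono[OF aba] by auto
  have "Y \<inter> unskippable f V ?G \<noteq> {}" if "Y \<in> ?G" for Y
  proof (rule unskippable_hits[OF fin abaG inj that])
    show "Y \<inter> V \<noteq> {}" using that \<open>k > 0\<close> by auto
  qed
  moreover have "finite (unskippable f V ?G)" using fin unfolding unskippable_def by auto
  ultimately have "\<exists>R\<subseteq>unskippable f V ?G. (\<forall>X\<in>?G. X \<inter> R \<noteq> {}) \<and> (\<forall>r\<in>R. \<exists>X\<in>?G. X \<inter> R = {r})"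
    by (intro minimal_hitting_set)
  then obtain R where R: "R \<subseteq> unskippable f V ?G" "\<forall>X\<in>?G. X \<inter> R \<noteq> {}"
    "\<forall>r\<in>R. \<exists>X\<in>?G. X \<inter> R = {r}"
    by (elim exE conjE)
  have RV: "R \<subseteq> V" using R(1) unfolding unskippable_def by auto
  then have finR: "finite R" using fin finite_subset by blast
  have key: "\<exists>Y\<in>?G. \<exists>a\<in>X \<inter> R. \<exists>c\<in>X \<inter> R. a \<notin> Y \<and> c \<notin> Y \<and> (\<forall>z\<in>Y \<inter> V. f a < f z \<and> f z < f c) \<and> card (Y \<inter> (V - R)) \<ge> k - 1"
    if X3: "card (X \<inter> R) \<ge> 3" for X
  proof -
    have "finite (X \<inter> R)" "inj_on f (X \<inter> R)" using finR RV inj by (auto intro: inj_on_subset)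
    then obtain a b c where abc: "a \<in> X \<inter> R" "b \<in> X \<inter> R" "c \<in> X \<inter> R" "f a < f b" "f b < f c"
      using three_ordered[OF _ _ X3, of f] by blast
    obtain Y where Y: "Y \<in> ?G" "Y \<inter> R = {b}" using R(3) abc(2) by blast
    have "Y \<inter> (V - R) = (Y \<inter> V) - {b}" using Y(2) by blast
    moreover have "card (Y \<inter> V) \<ge> k" using Y(1) by simp
    ultimately have "card (Y \<inter> (V - R)) \<ge> k - 1"
      using diff_card_le_card_Diff[of "{b}" "Y \<inter> V"] by simp
    moreover have "\<forall>z\<in>Y \<inter> V. f a < f z \<and> f z < f c"
      using private_between[OF R(1) inj Y(1,2), of a c] abc by blast
    moreover have "a \<notin> Y" "c \<notin> Y" using Y(2) abc by fastforce+
    ultimately show ?thesis using Y(1) abc(1,3) by (intro bexI[of _ Y] bexI[of _ a] bexI[of _ c] conjI)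
  qed
  show ?thesis
  proof (intro exI[of _ R] conjI RV ballI allI impI)
    show "Y \<inter> R \<noteq> {}" if "Y \<in> \<F>" "card (Y \<inter> V) \<ge> k" for Y using bspec[OF R(2), of Y] that by auto
    show "card (X \<inter> (V - R)) \<ge> k - 1" if X: "contiguous f V X" "card (X \<inter> R) \<ge> 3" for X
    proof -
      obtain Y a c where Y: "a \<in> X \<inter> R" "c \<in> X \<inter> R" "\<forall>z\<in>Y \<inter> V. f a < f z \<and> f z < f c"
        "card (Y \<inter> (V - R)) \<ge> k - 1" using key[OF X(2)] by blast
      have "z \<in> X" if z: "z \<in> Y" "z \<in> V" for z
        using \<open>contiguous f V X\<close>[unfolded contiguous_def, rule_format, of a z c] Y z RV by auto
      then have "Y \<inter> (V - R) \<subseteq> X \<inter> (V - R)" by auto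
      then have "card (Y \<inter> (V - R)) \<le> card (X \<inter> (V - R))" using fin by (intro card_mono) auto
      then show ?thesis using Y by linarith
    qed
    show "card (X \<inter> (V - R)) \<ge> k - 1" if X: "X \<in> \<F>" "card (X \<inter> V) \<ge> k + 1" for X
    proof (cases "card (X \<inter> R) \<ge> 3")
      case True
      obtain Y a c where Y: "Y \<in> \<F>" "a \<in> X \<inter> R" "c \<in> X \<inter> R" "a \<notin> Y" "c \<notin> Y" "\<forall>z\<in>Y \<inter> V. f a < f z \<and> f z < f c"
        "card (Y \<inter> (V - R)) \<ge> k - 1" using key[OF True] by blast
      have "Y \<inter> (V - R) \<subseteq> X \<inter> (V - R)"
      proof
        fix z assume "z \<in> Y \<inter> (V - R)"
        then have z: "z \<in> Y" "z \<in> V" "z \<notin> R" by auto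
        moreover have "a \<in> V" "c \<in> V" "a \<in> X" "c \<in> X" "f a < f z" "f z < f c" using Y z RV by auto
        ultimately show "z \<in> X \<inter> (V - R)" using ABA_freeD[OF aba X(1) Y(1), of a z c] Y(4,5) by blast
      qed
      then have "card (Y \<inter> (V - R)) \<le> card (X \<inter> (V - R))" using fin by (intro card_mono) auto
      then show ?thesis using Y by linarith
    next
      case False
      have "X \<inter> V = (X \<inter> R) \<union> (X \<inter> (V - R))" using RV by auto
      then have "card (X \<inter> V) \<le> card (X \<inter> R) + card (X \<inter> (V - R))"
        using card_Un_le[of "X \<inter> R" "X \<inter> (V - R)"] by simp
      then show ?thesis using False X(2) by linarith
    qed
  qed
qed

text \<open>Two sparse hitting sets get the colours 0 and 1, the remainder alternates. The
  parameters 5 and 4 make six points suffice: a member of \<open>\<F>\<close> hits \<open>R\<close>,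
  keeps four points and so hits \<open>S\<close>; a contiguous set keeps at least four points
  outside \<open>R\<close> and two outside \<open>S\<close>, where alternation works.\<close>

lemma two_colouring:
  assumes fin: "finite V" and inj: "inj_on f V" and aba: "ABA_free f V \<F>"
  shows "\<exists>c :: 'a \<Rightarrow> nat. (\<forall>x. c x < 2) \<and>
    (\<forall>Y\<in>\<F>. card (Y \<inter> V) \<ge> 6 \<longrightarrow> bichromatic c (Y \<inter> V)) \<and>
    (\<forall>X. contiguous f V X \<longrightarrow> card (X \<inter> V) \<ge> 6 \<longrightarrow> bichromatic c (X \<inter> V))"
proof -
  obtain R where R: "R \<subseteq> V"
    "\<forall>Y\<in>\<F>. card (Y \<inter> V) \<ge> 5 \<longrightarrow> Y \<inter> R \<noteq> {}"
    "\<forall>X. contiguous f V X \<longrightarrow> card (X \<inter> R) \<ge> 3 \<longrightarrow> card (X \<inter> (V - R)) \<ge> 5 - 1"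
    "\<forall>Y\<in>\<F>. card (Y \<inter> V) \<ge> 5 + 1 \<longrightarrow> card (Y \<inter> (V - R)) \<ge> 5 - 1"
    using sparse_hitting_set[OF fin inj aba, of 5] by force
  have V': "finite (V - R)" "inj_on f (V - R)" "ABA_free f (V - R) \<F>"
    using fin inj aba by (auto intro: inj_on_diff ABA_free_mono)
  obtain S where S: "S \<subseteq> V - R"
    "\<forall>Y\<in>\<F>. card (Y \<inter> (V - R)) \<ge> 4 \<longrightarrow> Y \<inter> S \<noteq> {}"
    "\<forall>X. contiguous f (V - R) X \<longrightarrow> card (X \<inter> S) \<ge> 3 \<longrightarrow> card (X \<inter> (V - R - S)) \<ge> 4 - 1"
    using sparse_hitting_set[OF V', of 4] by force
  let ?F = "V - R - S"
  define c where "c x = (if x \<in> R then 0 else if x \<in> S then 1 else rank_parity f ?F x)" for x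
  show ?thesis
  proof (intro exI[of _ c] conjI ballI allI impI)
    show "c x < 2" for x unfolding c_def rank_parity_def by auto
    show "bichromatic c (Y \<inter> V)" if Y: "Y \<in> \<F>" "card (Y \<inter> V) \<ge> 6" for Y
    proof -
      have "Y \<inter> R \<noteq> {}" using R(2) Y by simp
      moreover have "card (Y \<inter> (V - R)) \<ge> 4" using R(4) Y by simp
      then have "Y \<inter> S \<noteq> {}" using S(2) Y by simp
      ultimately obtain r s where "r \<in> Y \<inter> R" "s \<in> Y \<inter> S" by blast
      then have "c r = 0" "c s = 1" "r \<in> Y \<inter> V" "s \<in> Y \<inter> V" using R S unfolding c_def by auto
      then show ?thesis unfolding bichromatic_def by (metis zero_neq_one)
    qed
    show "bichromatic c (X \<inter> V)" if X: "contiguous f V X" "card (X \<inter> V) \<ge> 6" for X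
    proof -
      have cX: "contiguous f (V - R) X" "contiguous f ?F X" using X(1) unfolding contiguous_def by blast+
      have "X \<inter> V = (X \<inter> R) \<union> (X \<inter> (V - R))" using R by auto
      then have 1: "card (X \<inter> V) \<le> card (X \<inter> R) + card (X \<inter> (V - R))" by (metis card_Un_le)
      have "X \<inter> (V - R) = (X \<inter> S) \<union> (X \<inter> ?F)" using S by auto
      then have 2: "card (X \<inter> (V - R)) \<le> card (X \<inter> S) + card (X \<inter> ?F)" by (metis card_Un_le)
      have "card (X \<inter> ?F) \<ge> 2"
        using 1 2 R(3)[rule_format, OF X(1)] S(3)[rule_format, OF cX(1)] X(2) by linarith
      then have "bichromatic (rank_parity f ?F) (X \<inter> ?F)"
        using rank_parity_bichromatic[OF _ _ cX(2)] fin inj by (auto intro: inj_on_diff)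
      moreover have "bichromatic (rank_parity f ?F) (X \<inter> ?F) = bichromatic c (X \<inter> ?F)"
        by (rule bichromatic_cong) (auto simp: c_def)
      ultimately show ?thesis by (metis Diff_subset Int_mono bichromatic_mono order_refl subset_trans)
    qed
  qed
qed

text \<open>The families exchange roles on two minimal hitting sets. On \<open>R\<close>, chosen for
  \<open>\<T>\<close>, the members of \<open>\<T>\<close> are intervals and \<open>\<B>\<close>
  avoids the pattern; on \<open>S\<close>, chosen for \<open>\<B>\<close>, it is the other way
  round. \<open>two_colouring\<close> treats exactly this mixture, and twelve points within
  \<open>R\<close> and \<open>S\<close> leave six in one of them.\<close>

lemma three_colouring:
  assumes fin: "finite W" and inj: "inj_on f W" and T: "ABA_free f W \<T>" and B: "ABA_free f W \<B>"
  shows "\<exists>c :: 'a \<Rightarrow> nat. (\<forall>x. c x < 3) \<and>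
    (\<forall>X\<in>\<T> \<union> \<B>. card (X \<inter> W) \<ge> 12 \<longrightarrow> bichromatic c (X \<inter> W)) \<and>
    (\<forall>X\<in>\<T>. X \<inter> W \<noteq> {} \<longrightarrow> (\<exists>x\<in>X \<inter> W. c x \<noteq> 2))"
proof -
  have "\<exists>R\<subseteq>W. (\<forall>X\<in>{X\<in>\<T>. X \<inter> W \<noteq> {}}. X \<inter> R \<noteq> {}) \<and> (\<forall>r\<in>R. \<exists>X\<in>{X\<in>\<T>. X \<inter> W \<noteq> {}}. X \<inter> R = {r})"
    by (rule minimal_hitting_set[OF fin]) simp
  then obtain R where R0: "R \<subseteq> W" "\<forall>X\<in>{X\<in>\<T>. X \<inter> W \<noteq> {}}. X \<inter> R \<noteq> {}"
    "\<forall>r\<in>R. \<exists>X\<in>{X\<in>\<T>. X \<inter> W \<noteq> {}}. X \<inter> R = {r}"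
    by (elim exE conjE)
  have R2: "X \<inter> R \<noteq> {}" if "X \<in> \<T>" "X \<inter> W \<noteq> {}" for X
    using bspec[OF R0(2), of X] that by simp
  have R3: "\<exists>X\<in>\<T>. X \<inter> R = {r}" if "r \<in> R" for r
    using bspec[OF R0(3) that] by (elim bexE) (rule bexI, assumption, simp)
  note R = R0(1) R2 R3
  let ?V = "W - R"
  have finV: "finite ?V" using fin by auto
  have "\<exists>S\<subseteq>?V. (\<forall>X\<in>{X\<in>\<B>. X \<inter> ?V \<noteq> {}}. X \<inter> S \<noteq> {}) \<and> (\<forall>r\<in>S. \<exists>X\<in>{X\<in>\<B>. X \<inter> ?V \<noteq> {}}. X \<inter> S = {r})"
    by (rule minimal_hitting_set[OF finV]) simp
  then obtain S where S0: "S \<subseteq> ?V" "\<forall>X\<in>{X\<in>\<B>. X \<inter> ?V \<noteq> {}}. X \<inter> S \<noteq> {}"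
    "\<forall>r\<in>S. \<exists>X\<in>{X\<in>\<B>. X \<inter> ?V \<noteq> {}}. X \<inter> S = {r}"
    by (elim exE conjE)
  have S2: "X \<inter> S \<noteq> {}" if "X \<in> \<B>" "X \<inter> ?V \<noteq> {}" for X
    using bspec[OF S0(2), of X] that by simp
  have S3: "\<exists>X\<in>\<B>. X \<inter> S = {r}" if "r \<in> S" for r
    using bspec[OF S0(3) that] by (elim bexE) (rule bexI, assumption, simp)
  note S = S0(1) S2 S3
  have cR: "contiguous f R X" if "X \<in> \<T>" for X
    by (rule minimal_hitting_contiguous[OF T R(1) R(3) that])
  have cS: "contiguous f S X" if "X \<in> \<B>" for X
    by (rule minimal_hitting_contiguous[OF B _ S(3) that]) (use S in blast)
  have SW: "S \<subseteq> W" using S by auto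
  have fRS: "finite R" "finite S" "inj_on f R" "inj_on f S"
    using R(1) SW fin inj by (auto intro: inj_on_subset finite_subset)
  obtain c1 :: "'a \<Rightarrow> nat" where c1: "\<forall>x. c1 x < 2" "\<forall>Y\<in>\<B>. card (Y \<inter> R) \<ge> 6 \<longrightarrow> bichromatic c1 (Y \<inter> R)"
    "\<forall>X. contiguous f R X \<longrightarrow> card (X \<inter> R) \<ge> 6 \<longrightarrow> bichromatic c1 (X \<inter> R)"
    using two_colouring[OF fRS(1,3) ABA_free_mono[OF B R(1) order_refl]] by (elim exE conjE)
  obtain c2 :: "'a \<Rightarrow> nat" where c2: "\<forall>x. c2 x < 2" "\<forall>Y\<in>\<T>. card (Y \<inter> S) \<ge> 6 \<longrightarrow> bichromatic c2 (Y \<inter> S)"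
    "\<forall>X. contiguous f S X \<longrightarrow> card (X \<inter> S) \<ge> 6 \<longrightarrow> bichromatic c2 (X \<inter> S)"
    using two_colouring[OF fRS(2,4) ABA_free_mono[OF T SW order_refl]] by (elim exE conjE)
  define c where "c x = (if x \<in> R then c1 x else if x \<in> S then c2 x else 2)" for x
  have cc1: "bichromatic c (X \<inter> R) = bichromatic c1 (X \<inter> R)" for X
    by (rule bichromatic_cong) (auto simp: c_def)
  have cc2: "bichromatic c (X \<inter> S) = bichromatic c2 (X \<inter> S)" for X
    by (rule bichromatic_cong) (use S in \<open>auto simp: c_def\<close>)
  have lt: "c x < 2" if "x \<in> R \<union> S" for x using that c1(1) c2(1) by (auto simp: c_def)
  show ?thesis
  proof (intro exI[of _ c] conjI ballI allI impI)
    show "c x < 3" for x using less_SucI[OF spec[OF c1(1), of x]] less_SucI[OF spec[OF c2(1), of x]] by (auto simp: c_def numeral_3_eq_3 numeral_2_eq_2)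
    show "\<exists>x\<in>X \<inter> W. c x \<noteq> 2" if X: "X \<in> \<T>" "X \<inter> W \<noteq> {}" for X
    proof -
      obtain x where "x \<in> X" "x \<in> R" using R(2)[OF X] by blast
      then show ?thesis using lt[of x] R(1) by (intro bexI[of _ x]) auto
    qed
    show "bichromatic c (X \<inter> W)" if X: "X \<in> \<T> \<union> \<B>" "card (X \<inter> W) \<ge> 12" for X
    proof (cases "X \<inter> W \<subseteq> R \<union> S")
      case True
      have "X \<inter> W = (X \<inter> R) \<union> (X \<inter> S)" using True R(1) SW by auto
      then have "card (X \<inter> W) \<le> card (X \<inter> R) + card (X \<inter> S)" by (metis card_Un_le)
      then consider "card (X \<inter> R) \<ge> 6" | "card (X \<inter> S) \<ge> 6" using X by linarith
      then show ?thesis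
      proof cases
        case 1
        then have "bichromatic c (X \<inter> R)" using c1 cR X cc1 by blast
        then show ?thesis by (rule bichromatic_mono) (use R in auto)
      next
        case 2
        then have "bichromatic c (X \<inter> S)" using c2 cS X cc2 by blast
        then show ?thesis by (rule bichromatic_mono) (use SW in auto)
      qed
    next
      case False
      then obtain z where z: "z \<in> X \<inter> W" "z \<notin> R" "z \<notin> S" by auto
      then have "c z = 2" by (auto simp: c_def)
      \<comment> \<open>A member of \<open>\<B>\<close> containing \<open>z\<close> meets
        \<open>W - R\<close> and therefore \<open>S\<close>; a member of \<open>\<T>\<close> meets
        \<open>R\<close> as soon as it meets \<open>W\<close>.\<close>
      moreover have "X \<inter> (R \<union> S) \<noteq> {}"
        using X z R(2)[of X] S(2)[of X] by blast
      then obtain y where "y \<in> X \<inter> (R \<union> S)" by blast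
      then have "c y < 2" "y \<in> X \<inter> W" using lt R(1) SW by auto
      ultimately show ?thesis using z unfolding bichromatic_def by (metis less_irrefl)
    qed
  qed
qed

section \<open>Dominating points for two transitive relations\<close>

text \<open>In terms of two-coloured tournaments this is the theorem of Sands, Sauer and Woodrow. If
  there is no dominator, the induction gives every \<open>V - {v}\<close> a dominator
  \<open>\<sigma> v\<close> that fails only for \<open>v\<close>; so \<open>\<sigma> v\<close> is
  itself below \<open>v\<close> in one of the relations.\<close>

lemma two_relation_dominator:
  assumes "finite V" "V \<noteq> {}"
    and P: "\<And>x y z. P x y \<Longrightarrow> P y z \<Longrightarrow> P x z" and Q: "\<And>x y z. Q x y \<Longrightarrow> Q y z \<Longrightarrow> Q x z"
    and "\<And>x y. x \<in> V \<Longrightarrow> y \<in> V \<Longrightarrow> x \<noteq> y \<Longrightarrow> P x y \<or> P y x \<or> Q x y \<or> Q y x"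
  shows "\<exists>s\<in>V. \<forall>p\<in>V. p \<noteq> s \<longrightarrow> P p s \<or> Q p s"
  using assms(1,2,5)
proof (induction "card V" arbitrary: V rule: less_induct)
  case less
  show ?case
  proof (rule ccontr)
    assume no: "\<not> ?case"
    have "\<exists>s\<in>V. s \<noteq> v \<and> (\<forall>p\<in>V. p \<noteq> s \<longrightarrow> p \<noteq> v \<longrightarrow> P p s \<or> Q p s) \<and> \<not> P v s \<and> \<not> Q v s \<and> (P s v \<or> Q s v)"
      if v: "v \<in> V" for v
    proof -
      have "V - {v} \<noteq> {}" using no v by blast
      moreover have "card (V - {v}) < card V" using v less.prems(1) by (meson card_Diff1_less)
      ultimately obtain s where s: "s \<in> V - {v}" "\<forall>p\<in>V - {v}. p \<noteq> s \<longrightarrow> P p s \<or> Q p s"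
        using less.hyps[of "V - {v}"] less.prems(1,3) by (metis DiffD1 finite_Diff)
      have "\<not> (P v s \<or> Q v s)" using no s by blast
      then show ?thesis using less.prems(3)[of v s] v s by blast
    qed
    then have "\<exists>\<sigma>. \<forall>v\<in>V. \<sigma> v \<in> V \<and> \<sigma> v \<noteq> v \<and> (\<forall>p\<in>V. p \<noteq> \<sigma> v \<longrightarrow> p \<noteq> v \<longrightarrow> P p (\<sigma> v) \<or> Q p (\<sigma> v)) \<and>
        \<not> P v (\<sigma> v) \<and> \<not> Q v (\<sigma> v) \<and> (P (\<sigma> v) v \<or> Q (\<sigma> v) v)"
      by (simp only: Bex_def) (rule bchoice, blast)
    then obtain \<sigma> where \<sigma>: "\<And>v. v \<in> V \<Longrightarrow> \<sigma> v \<in> V" "\<And>v. v \<in> V \<Longrightarrow> \<sigma> v \<noteq> v"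
      "\<And>v p. v \<in> V \<Longrightarrow> p \<in> V \<Longrightarrow> p \<noteq> \<sigma> v \<Longrightarrow> p \<noteq> v \<Longrightarrow> P p (\<sigma> v) \<or> Q p (\<sigma> v)"
      "\<And>v. v \<in> V \<Longrightarrow> \<not> P v (\<sigma> v)" "\<And>v. v \<in> V \<Longrightarrow> \<not> Q v (\<sigma> v)" "\<And>v. v \<in> V \<Longrightarrow> P (\<sigma> v) v \<or> Q (\<sigma> v) v"
      by blast
    \<comment> \<open>The relation is inherited along \<open>\<sigma>\<close>. Unless
      \<open>v\<close> equals \<open>\<sigma> (\<sigma> v)\<close>, it is below that point. If by
      \<open>P\<close>, transitivity puts \<open>\<sigma> v\<close> below
      \<open>\<sigma> (\<sigma> v)\<close>; if by \<open>Q\<close>, then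
      \<open>Q (\<sigma> (\<sigma> v)) (\<sigma> v)\<close> would put \<open>v\<close> below
      \<open>\<sigma> v\<close>. Both are excluded.\<close>
    have PQ: "\<not> Q (\<sigma> (\<sigma> v)) (\<sigma> v)" if "v \<in> V" "P (\<sigma> v) v" for v
      using \<sigma>(3)[of "\<sigma> v" v] \<sigma>(1,2,4,5)[of v] \<sigma>(1,4,5)[of "\<sigma> v"] that P Q by metis
    have QP: "\<not> P (\<sigma> (\<sigma> v)) (\<sigma> v)" if "v \<in> V" "Q (\<sigma> v) v" for v
      using \<sigma>(3)[of "\<sigma> v" v] \<sigma>(1,2,4,5)[of v] \<sigma>(1,4,5)[of "\<sigma> v"] that P Q by metis
    \<comment> \<open>Iterating \<open>\<sigma>\<close> descends in one fixed relation. As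
      \<open>V\<close> is finite, the orbit repeats, and then some point is equal to or below its
      own image.\<close>
    have orbit: False if R: "\<And>x y z. R x y \<Longrightarrow> R y z \<Longrightarrow> R x z" "\<And>v. v \<in> V \<Longrightarrow> \<not> R v (\<sigma> v)"
      and step: "\<And>v. v \<in> V \<Longrightarrow> R (\<sigma> v) v \<Longrightarrow> R (\<sigma> (\<sigma> v)) (\<sigma> v)"
      and v: "v \<in> V" "R (\<sigma> v) v" for R v
    proof -
      define x where "x n = (\<sigma> ^^ n) v" for n
      have x: "x (Suc n) = \<sigma> (x n)" for n by (simp add: x_def)
      have xV: "x n \<in> V \<and> R (x (Suc n)) (x n)" for n
        by (induction n) (use v \<sigma>(1) step in \<open>auto simp: x_def\<close>)
      have desc: "R (x (Suc n + k)) (x n)" for n k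
      proof (induction k)
        case 0 then show ?case using xV[of n] by simp
      next
        case (Suc k) then show ?case using R(1)[OF conjunct2[OF xV[of "Suc n + k"]]] by simp
      qed
      have "\<not> inj x"
        using less.prems(1) xV by (metis finite_imageD finite_subset image_subsetI infinite_UNIV_nat)
      then obtain k l where kl: "k < l" "x k = x l" by (metis injI linorder_neqE_nat)
      then obtain d where d: "l = Suc k + d" using less_iff_Suc_add by (metis add_Suc)
      show False
      proof (cases d)
        case 0 then show ?thesis using kl d x[of k] \<sigma>(2)[of "x k"] xV[of k] by simp
      next
        case (Suc e)
        then have "R (x l) (x (Suc k))" using desc[of "Suc k" e] d by simp
        then show ?thesis using R(2)[of "x k"] xV[of k] kl x[of k] by simp
      qed
    qed
    obtain v where v: "v \<in> V" using less.prems by blast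
    have stepP: "P (\<sigma> (\<sigma> v)) (\<sigma> v)" if "v \<in> V" "P (\<sigma> v) v" for v
      using PQ[OF that] \<sigma>(6)[OF \<sigma>(1)[OF that(1)]] by blast
    have stepQ: "Q (\<sigma> (\<sigma> v)) (\<sigma> v)" if "v \<in> V" "Q (\<sigma> v) v" for v
      using QP[OF that] \<sigma>(6)[OF \<sigma>(1)[OF that(1)]] by blast
    show False
    proof (cases "P (\<sigma> v) v")
      case True show ?thesis by (rule orbit[where R = P, OF P \<sigma>(4) stepP v True])
    next
      case False
      then have Qv: "Q (\<sigma> v) v" using \<sigma>(6)[OF v] by blast
      show ?thesis by (rule orbit[where R = Q, OF Q \<sigma>(5) stepQ v Qv])
    qed
  qed
qed

text \<open>Each term dominates what is left after its predecessors are removed, so later terms are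
  themselves below earlier ones. This makes every pair of terms comparable, as Ramsey's theorem will
  require.\<close>

lemma dominator_sequence:
  assumes "finite V"
    and P: "\<And>x y z. P x y \<Longrightarrow> P y z \<Longrightarrow> P x z" and Q: "\<And>x y z. Q x y \<Longrightarrow> Q y z \<Longrightarrow> Q x z"
    and total: "\<And>x y. x \<in> V \<Longrightarrow> y \<in> V \<Longrightarrow> x \<noteq> y \<Longrightarrow> P x y \<or> P y x \<or> Q x y \<or> Q y x"
    and "n \<le> card V"
  shows "\<exists>s::nat \<Rightarrow> 'a. inj_on s {..<n} \<and> s ` {..<n} \<subseteq> V \<and> (\<forall>t<n. \<forall>p\<in>V - s ` {..t}. P p (s t) \<or> Q p (s t))"
  using assms(5)
proof (induction n)
  case 0 show ?case by auto
next
  case (Suc n)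
  then have "n \<le> card V" by simp
  from Suc.IH[OF this] obtain s where s: "inj_on s {..<n}" "s ` {..<n} \<subseteq> V"
      "\<forall>t<n. \<forall>p\<in>V - s ` {..t}. P p (s t) \<or> Q p (s t)"
    by (elim exE conjE)
  let ?U = "V - s ` {..<n}"
  have "card (s ` {..<n}) < card V" using Suc.prems card_image_le[of "{..<n}" s] by simp
  then have "V \<noteq> s ` {..<n}" by blast
  then have U: "?U \<noteq> {}" using s(2) by blast
  have "\<exists>x\<in>?U. \<forall>p\<in>?U. p \<noteq> x \<longrightarrow> P p x \<or> Q p x"
  proof (rule two_relation_dominator[where P = P and Q = Q])
    show "P x z" if "P x y" "P y z" for x y z using that by (rule P)
    show "Q x z" if "Q x y" "Q y z" for x y z using that by (rule Q)
    show "P x y \<or> P y x \<or> Q x y \<or> Q y x" if "x \<in> ?U" "y \<in> ?U" "x \<noteq> y" for x y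
      using total[of x y] that by blast
  qed (use assms(1) U in auto)
  then obtain x where x: "x \<in> ?U" "\<forall>p\<in>?U. p \<noteq> x \<longrightarrow> P p x \<or> Q p x" ..
  have eq: "(s(n := x)) ` {..<n} = s ` {..<n}" by auto
  have eq2: "(s(n := x)) ` {..t} = s ` {..t}" if "t < n" for t using that by auto
  have eq3: "(s(n := x)) ` {..n} = insert x (s ` {..<n})" by (auto simp: lessThan_Suc_atMost[symmetric] lessThan_Suc)
  show ?case
  proof (intro exI[of _ "s(n := x)"] conjI allI impI ballI)
    show "inj_on (s(n := x)) {..<Suc n}" using s(1) x(1) by (auto simp: lessThan_Suc inj_on_def)
    show "(s(n := x)) ` {..<Suc n} \<subseteq> V" using s(2) x(1) by (auto simp: lessThan_Suc)
    fix t p assume t: "t < Suc n" and p: "p \<in> V - (s(n := x)) ` {..t}"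
    show "P p ((s(n := x)) t) \<or> Q p ((s(n := x)) t)"
    proof (cases "t = n")
      case True show ?thesis using x(2) p unfolding True eq3 by simp
    next
      case False
      then have "t < n" using t by simp
      then show ?thesis using s(3) p unfolding eq2[OF \<open>t < n\<close>] by simp
    qed
  qed
qed

definition dominated :: "('a \<Rightarrow> 'a \<Rightarrow> bool) \<Rightarrow> 'a set \<Rightarrow> ('a \<Rightarrow> nat) \<Rightarrow> 'a \<Rightarrow> bool" where
  "dominated L S c p \<longleftrightarrow> (\<exists>x\<in>S. \<exists>y\<in>S. c x \<noteq> c y \<and> L p x \<and> L p y)"

text \<open>The colouring alternates along four dominators that form a chain in one of the relations, say \<open>P\<close>:
  a point that is \<open>P\<close>-below one of the last three is also \<open>P\<close>-below its predecessor, and any other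
  point is \<open>Q\<close>-below the last two.\<close>

lemma bichromatic_dominators_chain:
  fixes P Q :: "'a \<Rightarrow> 'a \<Rightarrow> bool"
  assumes P: "\<And>x y z. P x y \<Longrightarrow> P y z \<Longrightarrow> P x z"
    and s: "inj_on s {..<n::nat}" and dom: "\<And>t. t < n \<Longrightarrow> P p (s t) \<or> Q p (s t)"
    and t: "t1 < t2" "t2 < t3" "t3 < t4" "t4 < n"
    and chain: "P (s t2) (s t1)" "P (s t3) (s t2)" "P (s t4) (s t3)"
  defines "c \<equiv> \<lambda>x. if x = s t1 \<or> x = s t3 then 0 else (1::nat)"
  shows "dominated P (s ` {..<n}) c p \<or> dominated Q (s ` {..<n}) c p"
proof -
  have c: "c (s t1) = 0" "c (s t2) = 1" "c (s t3) = 0" "c (s t4) = 1"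
    using t inj_on_eq_iff[OF s] by (auto simp: c_def)
  have S: "s t1 \<in> s ` {..<n}" "s t2 \<in> s ` {..<n}" "s t3 \<in> s ` {..<n}" "s t4 \<in> s ` {..<n}"
    using t by auto
  consider "P p (s t2)" | "P p (s t3)" | "P p (s t4)" | "Q p (s t3)" "Q p (s t4)"
    using dom[of t3] dom[of t4] t by auto
  then show ?thesis
  proof cases
    case 1
    then have "P p (s t1)" using P chain by blast
    with 1 show ?thesis using S c unfolding dominated_def by (intro disjI1 bexI[of _ "s t1"] bexI[of _ "s t2"]) simp_all
  next
    case 2
    then have "P p (s t2)" using P chain by blast
    with 2 show ?thesis using S c unfolding dominated_def by (intro disjI1 bexI[of _ "s t2"] bexI[of _ "s t3"]) simp_all
  next
    case 3
    then have "P p (s t3)" using P chain by blast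
    with 3 show ?thesis using S c unfolding dominated_def by (intro disjI1 bexI[of _ "s t3"] bexI[of _ "s t4"]) simp_all
  next
    case 4
    then show ?thesis using S c unfolding dominated_def by (intro disjI2 bexI[of _ "s t3"] bexI[of _ "s t4"]) simp_all
  qed
qed

lemma four_ordered:
  assumes "card R = 4"
  shows "\<exists>a\<in>R. \<exists>b\<in>R. \<exists>c\<in>R. \<exists>d\<in>R. a < b \<and> b < c \<and> c < (d::nat)"
proof -
  define l where "l = sorted_list_of_set R"
  have fin: "finite R" using assms card.infinite by fastforce
  have l: "length l = 4" "set l = R" "sorted_wrt (<) l" using assms fin by (auto simp: l_def)
  have "l ! 0 < l ! 1" "l ! 1 < l ! 2" "l ! 2 < l ! 3" using l sorted_wrt_nth_less[OF l(3)] by auto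
  moreover have "l ! 0 \<in> R" "l ! 1 \<in> R" "l ! 2 \<in> R" "l ! 3 \<in> R" using l nth_mem by force+
  ultimately show ?thesis by blast
qed

text \<open>In a long dominator sequence a pair of indices is an edge if the later term is
  \<open>P\<close>-below the earlier one; a non-edge is then \<open>Q\<close>-below. Four indices of
  one kind give the chain. \<open>N\<close> is the Ramsey bound for 4 and 4; a set with fewer points
  serves as its own \<open>S\<close>.\<close>

lemma bichromatic_dominators:
  "\<exists>N::nat. \<forall>(V::'a set) P Q. finite V \<longrightarrow> (\<forall>x y z. P x y \<longrightarrow> P y z \<longrightarrow> P x z) \<longrightarrow> (\<forall>x y z. Q x y \<longrightarrow> Q y z \<longrightarrow> Q x z) \<longrightarrow>
    (\<forall>x\<in>V. \<forall>y\<in>V. x \<noteq> y \<longrightarrow> P x y \<or> P y x \<or> Q x y \<or> Q y x) \<longrightarrow>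
    (\<exists>S\<subseteq>V. card S \<le> N \<and> (\<exists>c::'a \<Rightarrow> nat. (\<forall>x. c x < 2) \<and> (\<forall>p\<in>V - S.
      dominated P S c p \<or> dominated Q S c p)))"
proof -
  obtain N :: nat where N: "\<And>(V::nat set) E. finite V \<Longrightarrow> card V \<ge> N \<Longrightarrow>
      \<exists>R\<subseteq>V. card R = 4 \<and> clique R E \<or> card R = 4 \<and> indep R E"
    using ramsey2[where 'a = nat and m = 4 and n = 4] by blast
  show ?thesis
  proof (intro exI[of _ N] allI impI)
    fix V :: "'a set" and P Q
    assume fin: "finite V" and P0: "\<forall>x y z. P x y \<longrightarrow> P y z \<longrightarrow> P x z" and Q0: "\<forall>x y z. Q x y \<longrightarrow> Q y z \<longrightarrow> Q x z"
      and total: "\<forall>x\<in>V. \<forall>y\<in>V. x \<noteq> y \<longrightarrow> P x y \<or> P y x \<or> Q x y \<or> Q y x"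
    note P = P0[rule_format] and Q = Q0[rule_format]
    show "\<exists>S\<subseteq>V. card S \<le> N \<and> (\<exists>c::'a \<Rightarrow> nat. (\<forall>x. c x < 2) \<and> (\<forall>p\<in>V - S.
      dominated P S c p \<or> dominated Q S c p))"
    proof (cases "N \<le> card V")
      case False
      then show ?thesis by (intro exI[of _ V] conjI exI[of _ "\<lambda>_. 0"]) auto
    next
      case True
      have "\<exists>s::nat \<Rightarrow> 'a. inj_on s {..<N} \<and> s ` {..<N} \<subseteq> V \<and> (\<forall>t<N. \<forall>p\<in>V - s ` {..t}. P p (s t) \<or> Q p (s t))"
      proof (rule dominator_sequence[where P = P and Q = Q, OF fin])
        show "P x z" if "P x y" "P y z" for x y z using that by (rule P)
        show "Q x z" if "Q x y" "Q y z" for x y z using that by (rule Q)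
        show "P x y \<or> P y x \<or> Q x y \<or> Q y x" if "x \<in> V" "y \<in> V" "x \<noteq> y" for x y
          using total that by blast
      qed (rule True)
      then obtain s where s: "inj_on s {..<N}" "s ` {..<N} \<subseteq> V" "\<forall>t<N. \<forall>p\<in>V - s ` {..t}. P p (s t) \<or> Q p (s t)"
        by (elim exE conjE)
      have later: "P (s u) (s t) \<or> Q (s u) (s t)" if "t < u" "u < N" for t u
      proof -
        have "s u \<notin> s ` {..t}" using that inj_onD[OF s(1), of u] by fastforce
        moreover have "s u \<in> V" using s(2) that by auto
        ultimately show ?thesis using s(3) that by auto
      qed
      define E where "E = {{t, u} |t u. t < u \<and> P (s u) (s t)}"
      have E: "P (s u) (s t)" if "{t, u} \<in> E" "t < u" for t u
        using that unfolding E_def by (auto simp: doubleton_eq_iff)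
      obtain R where R: "R \<subseteq> {..<N}" "card R = 4" "clique R E \<or> indep R E"
        using N[of "{..<N}" E] by auto
      obtain t1 t2 t3 t4 where t: "t1 \<in> R" "t2 \<in> R" "t3 \<in> R" "t4 \<in> R" "t1 < t2" "t2 < t3" "t3 < t4"
        using four_ordered[OF R(2)] by blast
      then have "t4 < N" "t3 < N" "t2 < N" using R(1) by auto
      have dom: "P p (s t) \<or> Q p (s t)" if "p \<in> V - s ` {..<N}" "t < N" for p t
        using s(3) that by (auto simp: image_iff)
      have "(P (s t2) (s t1) \<and> P (s t3) (s t2) \<and> P (s t4) (s t3)) \<or> (Q (s t2) (s t1) \<and> Q (s t3) (s t2) \<and> Q (s t4) (s t3))"
        using R(3)
      proof
        assume "clique R E"
        then have "{t1, t2} \<in> E" "{t2, t3} \<in> E" "{t3, t4} \<in> E" using t unfolding clique_def by auto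
        then show ?thesis using E t by blast
      next
        assume "indep R E"
        then have "{t1, t2} \<notin> E" "{t2, t3} \<notin> E" "{t3, t4} \<notin> E" using t unfolding indep_def by auto
        then have "\<not> P (s t2) (s t1)" "\<not> P (s t3) (s t2)" "\<not> P (s t4) (s t3)" using t unfolding E_def by blast+
        then show ?thesis using later t \<open>t4 < N\<close> \<open>t3 < N\<close> \<open>t2 < N\<close> by blast
      qed
      note chain = this
      let ?c = "\<lambda>x. if x = s t1 \<or> x = s t3 then 0 else (1::nat)"
      have "dominated P (s ` {..<N}) ?c p \<or> dominated Q (s ` {..<N}) ?c p" if p: "p \<in> V - s ` {..<N}" for p
        using chain
      proof (elim disjE conjE)
        assume ch: "P (s t2) (s t1)" "P (s t3) (s t2)" "P (s t4) (s t3)"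
        show ?thesis
          by (rule bichromatic_dominators_chain[where P = P and Q = Q and s = s, OF P s(1) dom[OF p] t(5-7) \<open>t4 < N\<close> ch])
      next
        assume ch: "Q (s t2) (s t1)" "Q (s t3) (s t2)" "Q (s t4) (s t3)"
        have dom': "t < N \<Longrightarrow> Q p (s t) \<or> P p (s t)" for t using dom[OF p] by blast
        show ?thesis
          by (rule disj_commute[THEN iffD1], rule bichromatic_dominators_chain[where P = Q and Q = P and s = s, OF Q s(1) dom' t(5-7) \<open>t4 < N\<close> ch])
      qed
      moreover have "card (s ` {..<N}) \<le> N" using card_image_le[of "{..<N}" s] by simp
      ultimately show ?thesis using s(2)
        by (intro exI[of _ "s ` {..<N}"] conjI exI[of _ "\<lambda>x. if x = s t1 \<or> x = s t3 then 0 else (1::nat)"]) simp_all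
    qed
  qed
qed

lemma dominated_extend:
  assumes "dominated L S c p" "S \<subseteq> S'" "\<And>x. x \<in> S \<Longrightarrow> c' x = c x"
  shows "dominated L S' c' p"
  using assms unfolding dominated_def by (metis subsetD)

text \<open>The pairs are treated one after another, each on the points not yet used. The sets of
  dominators are thus disjoint, so their colourings cannot conflict and earlier domination
  persists.\<close>

lemma bichromatic_dominators_family:
  "\<exists>N::nat. \<forall>(V::'a set) (L::'i \<Rightarrow> 'a \<Rightarrow> 'a \<Rightarrow> bool) \<K>. finite V \<longrightarrow> finite \<K> \<longrightarrow> (\<forall>j x y z. L j x y \<longrightarrow> L j y z \<longrightarrow> L j x z) \<longrightarrow>
    (\<forall>(j,k)\<in>\<K>. \<forall>x\<in>V. \<forall>y\<in>V. x \<noteq> y \<longrightarrow> L j x y \<or> L j y x \<or> L k x y \<or> L k y x) \<longrightarrow>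
    (\<exists>S\<subseteq>V. card S \<le> N * card \<K> \<and> (\<exists>c::'a \<Rightarrow> nat. (\<forall>x. c x < 2) \<and>
      (\<forall>p\<in>V - S. \<forall>(j,k)\<in>\<K>. dominated (L j) S c p \<or> dominated (L k) S c p)))"
proof -
  obtain N :: nat where N: "\<forall>(V::'a set) P Q. finite V \<longrightarrow> (\<forall>x y z. P x y \<longrightarrow> P y z \<longrightarrow> P x z) \<longrightarrow> (\<forall>x y z. Q x y \<longrightarrow> Q y z \<longrightarrow> Q x z) \<longrightarrow>
    (\<forall>x\<in>V. \<forall>y\<in>V. x \<noteq> y \<longrightarrow> P x y \<or> P y x \<or> Q x y \<or> Q y x) \<longrightarrow>
    (\<exists>S\<subseteq>V. card S \<le> N \<and> (\<exists>c::'a \<Rightarrow> nat. (\<forall>x. c x < 2) \<and> (\<forall>p\<in>V - S. dominated P S c p \<or> dominated Q S c p)))"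
    by (rule exE[OF bichromatic_dominators])
  have "\<exists>S\<subseteq>V. card S \<le> N * card \<K> \<and> (\<exists>c::'a \<Rightarrow> nat. (\<forall>x. c x < 2) \<and>
      (\<forall>p\<in>V - S. \<forall>(j,k)\<in>\<K>. dominated (L j) S c p \<or> dominated (L k) S c p))"
    if "finite \<K>" and fin: "finite V" and tr: "\<forall>j x y z. L j x y \<longrightarrow> L j y z \<longrightarrow> L j x z"
      and "\<forall>(j,k)\<in>\<K>. \<forall>x\<in>V. \<forall>y\<in>V. x \<noteq> y \<longrightarrow> L j x y \<or> L j y x \<or> L k x y \<or> L k y x"
    for V :: "'a set" and L :: "'i \<Rightarrow> 'a \<Rightarrow> 'a \<Rightarrow> bool" and \<K>
    using that(1,4)
  proof (induction \<K> rule: finite_induct)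
    case empty
    show ?case by (intro exI[of _ "{}"] conjI exI[of _ "\<lambda>_. 0"]) auto
  next
    case (insert q \<K>)
    obtain j k where q: "q = (j, k)" by force
    have "\<forall>(j,k)\<in>\<K>. \<forall>x\<in>V. \<forall>y\<in>V. x \<noteq> y \<longrightarrow> L j x y \<or> L j y x \<or> L k x y \<or> L k y x"
      using insert.prems by blast
    from insert.IH[OF this] obtain S c where S: "S \<subseteq> V" "card S \<le> N * card \<K>" "\<forall>x. c x < (2::nat)"
      "\<forall>p\<in>V - S. \<forall>(j,k)\<in>\<K>. dominated (L j) S c p \<or> dominated (L k) S c p" by (elim exE conjE)
    have "\<forall>x\<in>V - S. \<forall>y\<in>V - S. x \<noteq> y \<longrightarrow> L j x y \<or> L j y x \<or> L k x y \<or> L k y x"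
      using insert.prems q by blast
    from N[THEN spec, THEN spec, THEN spec, THEN mp, THEN mp, THEN mp, THEN mp, OF finite_Diff[OF fin] spec[OF tr] spec[OF tr] this]
    obtain T d where T: "T \<subseteq> V - S" "card T \<le> N" "\<forall>x. d x < (2::nat)"
      "\<forall>p\<in>V - S - T. dominated (L j) T d p \<or> dominated (L k) T d p" by (elim exE conjE)
    define c' where "c' x = (if x \<in> S then c x else d x)" for x
    have "card (S \<union> T) \<le> N * card (insert q \<K>)"
      using card_Un_le[of S T] S(2) T(2) insert.hyps by simp
    moreover have "\<forall>x. c' x < 2" using S(3) T(3) by (simp add: c'_def)
    moreover have "dominated (L j') (S \<union> T) c' p \<or> dominated (L k') (S \<union> T) c' p"
      if p: "p \<in> V - (S \<union> T)" and jk: "(j', k') \<in> insert q \<K>" for p j' k'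
    proof (cases "(j', k') = q")
      case True
      then have "dominated (L j') T d p \<or> dominated (L k') T d p" using T(4) p q by blast
      moreover have "dominated M T d p \<Longrightarrow> dominated M (S \<union> T) c' p" for M
        by (rule dominated_extend[of _ T d]) (use T(1) in \<open>auto simp: c'_def\<close>)
      ultimately show ?thesis by blast
    next
      case False
      then have "dominated (L j') S c p \<or> dominated (L k') S c p" using S(4) p jk by blast
      moreover have "dominated M S c p \<Longrightarrow> dominated M (S \<union> T) c' p" for M
        by (rule dominated_extend[of _ S c]) (auto simp: c'_def)
      ultimately show ?thesis by blast
    qed
    ultimately show ?case using S(1) T(1)
      by (intro exI[of _ "S \<union> T"] conjI exI[of _ c']) auto
  qed
  then show ?thesis by (intro exI[of _ N] allI impI)
qed

section \<open>Colouring layer by layer\<close>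

definition below :: "'a set set \<Rightarrow> 'a \<Rightarrow> 'a \<Rightarrow> bool" where
  "below \<X> x y \<longleftrightarrow> (\<forall>X\<in>\<X>. x \<in> X \<longrightarrow> y \<in> X)"

lemma below_trans: "below \<X> x y \<Longrightarrow> below \<X> y z \<Longrightarrow> below \<X> x z"
  unfolding below_def by blast

definition incomparable :: "'a set set \<Rightarrow> 'a \<Rightarrow> 'a \<Rightarrow> bool" where
  "incomparable \<X> x y \<longleftrightarrow> \<not> below \<X> x y \<and> \<not> below \<X> y x"

text \<open>The interface between combinatorics and geometry: \<open>U\<close> ranges over the sets
  of families for which joint dominators may fail, and the geometry must supply one order and two
  groups. The index \<open>i\<close> has to go to \<open>T\<close>, the group to which
  \<open>three_colouring\<close> guarantees a colour other than 2.\<close>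

definition two_sided :: "('i \<Rightarrow> 'a set set) \<Rightarrow> 'i set \<Rightarrow> 'i \<Rightarrow> 'a set \<Rightarrow> bool" where
  "two_sided F J i R \<longleftrightarrow> (\<forall>U\<subseteq>J.
     (\<forall>j\<in>U. \<forall>k\<in>U. \<exists>x\<in>R. \<exists>y\<in>R. x \<noteq> y \<and> incomparable (F j) x y \<and> incomparable (F k) x y) \<longrightarrow>
     (\<exists>f T B. U = T \<union> B \<and> (i \<in> U \<longrightarrow> i \<in> T) \<and> inj_on f R \<and>
       ABA_free f R (\<Union>j\<in>T. F j) \<and> ABA_free f R (\<Union>j\<in>B. F j)))"

text \<open>\<open>S\<close> collects dominators for all jointly complete pairs; the other points
  fall into classes \<open>W U\<close> according to the set \<open>U\<close> of families in which
  they are undominated. Two indices of one such \<open>U\<close> are never jointly complete, so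
  \<open>two_sided\<close> applies. A large trace has twelve points in some class. If its family
  belongs to \<open>U\<close>, \<open>three_colouring\<close> decides; otherwise a single point
  drags two colours of \<open>S\<close> into the set.\<close>

lemma antichain_colouring:
  fixes J :: "'i set"
  assumes J: "finite J"
  shows "\<exists>M. \<forall>(R::'a set) F. \<forall>i\<in>J. finite R \<longrightarrow> two_sided F J i R \<longrightarrow>
     (\<exists>c::'a \<Rightarrow> nat. (\<forall>x. c x < 3) \<and> (\<forall>j\<in>J. \<forall>X\<in>F j. card (X \<inter> R) > M \<longrightarrow> bichromatic c (X \<inter> R)) \<and>
       (\<forall>X\<in>F i. X \<inter> R \<noteq> {} \<longrightarrow> (\<exists>x\<in>X \<inter> R. c x \<noteq> 2)))"
proof -
  obtain N :: nat where N: "\<forall>(V::'a set) (L::'i \<Rightarrow> 'a \<Rightarrow> 'a \<Rightarrow> bool) \<K>. finite V \<longrightarrow> finite \<K> \<longrightarrow> (\<forall>j x y z. L j x y \<longrightarrow> L j y z \<longrightarrow> L j x z) \<longrightarrow>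
    (\<forall>(j,k)\<in>\<K>. \<forall>x\<in>V. \<forall>y\<in>V. x \<noteq> y \<longrightarrow> L j x y \<or> L j y x \<or> L k x y \<or> L k y x) \<longrightarrow>
    (\<exists>S\<subseteq>V. card S \<le> N * card \<K> \<and> (\<exists>c::'a \<Rightarrow> nat. (\<forall>x. c x < 2) \<and>
      (\<forall>p\<in>V - S. \<forall>(j,k)\<in>\<K>. dominated (L j) S c p \<or> dominated (L k) S c p)))"
    by (rule exE[OF bichromatic_dominators_family])
  \<comment> \<open>At most \<open>N\<close> dominators for each pair of indices, and twelve points
    for each class.\<close>
  define M where "M = N * card (J \<times> J) + card (Pow J) * 12"
  show ?thesis
  proof (intro exI[of _ M] allI ballI impI)
    fix R :: "'a set" and F :: "'i \<Rightarrow> 'a set set" and i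
    assume i: "i \<in> J" and fin: "finite R" and ts: "two_sided F J i R"
    define L where "L j = below (F j)" for j
    define \<K> where "\<K> = {(j,k)\<in>J \<times> J. \<forall>x\<in>R. \<forall>y\<in>R. x \<noteq> y \<longrightarrow> L j x y \<or> L j y x \<or> L k x y \<or> L k y x}"
    have KJ: "\<K> \<subseteq> J \<times> J" "finite (J \<times> J)" using J by (auto simp: \<K>_def)
    then have finK: "finite \<K>" and cardK: "card \<K> \<le> card (J \<times> J)"
      using finite_subset card_mono by blast+
    have trL: "\<forall>j x y z. L j x y \<longrightarrow> L j y z \<longrightarrow> L j x z" unfolding L_def using below_trans by metis
    have total: "\<forall>(j,k)\<in>\<K>. \<forall>x\<in>R. \<forall>y\<in>R. x \<noteq> y \<longrightarrow> L j x y \<or> L j y x \<or> L k x y \<or> L k y x"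
      unfolding \<K>_def by blast
    obtain S d where S: "S \<subseteq> R" "card S \<le> N * card \<K>" "\<forall>x. d x < (2::nat)"
      "\<forall>p\<in>R - S. \<forall>(j,k)\<in>\<K>. dominated (L j) S d p \<or> dominated (L k) S d p"
      using N[THEN spec, THEN spec, THEN spec, THEN mp, THEN mp, THEN mp, THEN mp, OF fin finK trL total]
      by (elim exE conjE)
    define u where "u p = {j\<in>J. \<not> dominated (L j) S d p}" for p
    define W where "W U = {p\<in>R - S. u p = U}" for U
    have finW: "finite (W U)" for U using fin by (auto simp: W_def)
    have "\<exists>c::'a \<Rightarrow> nat. (\<forall>x. c x < 3) \<and> (\<forall>j\<in>U. \<forall>X\<in>F j. card (X \<inter> W U) \<ge> 12 \<longrightarrow> bichromatic c (X \<inter> W U)) \<and>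
        (i \<in> U \<longrightarrow> (\<forall>X\<in>F i. X \<inter> W U \<noteq> {} \<longrightarrow> (\<exists>x\<in>X \<inter> W U. c x \<noteq> 2)))" for U
    proof (cases "W U = {}")
      case True then show ?thesis by (intro exI[of _ "\<lambda>_. 0"]) simp
    next
      case False
      then obtain p where p: "p \<in> R - S" "u p = U" by (auto simp: W_def)
      have "\<exists>x\<in>R. \<exists>y\<in>R. x \<noteq> y \<and> incomparable (F j) x y \<and> incomparable (F k) x y" if jk: "j \<in> U" "k \<in> U" for j k
      proof -
        have "(j, k) \<notin> \<K>" using S(4) p jk unfolding u_def by blast
        moreover have "j \<in> J" "k \<in> J" using p jk unfolding u_def by auto
        ultimately obtain x y where "x \<in> R" "y \<in> R" "x \<noteq> y" "\<not> (L j x y \<or> L j y x \<or> L k x y \<or> L k y x)"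
          unfolding \<K>_def by blast
        then show ?thesis unfolding L_def incomparable_def by blast
      qed
      moreover have "U \<subseteq> J" using p unfolding u_def by auto
      ultimately have "\<exists>f T B. U = T \<union> B \<and> (i \<in> U \<longrightarrow> i \<in> T) \<and> inj_on f R \<and>
       ABA_free f R (\<Union>j\<in>T. F j) \<and> ABA_free f R (\<Union>j\<in>B. F j)"
        using ts unfolding two_sided_def by simp
      then obtain f T B where f: "U = T \<union> B" "i \<in> U \<longrightarrow> i \<in> T" "inj_on f R"
       "ABA_free f R (\<Union>j\<in>T. F j)" "ABA_free f R (\<Union>j\<in>B. F j)" by (elim exE conjE)
      have WR: "W U \<subseteq> R" by (auto simp: W_def)
      obtain c :: "'a \<Rightarrow> nat" where c: "\<forall>x. c x < 3"
        "\<forall>X\<in>(\<Union>j\<in>T. F j) \<union> (\<Union>j\<in>B. F j). card (X \<inter> W U) \<ge> 12 \<longrightarrow> bichromatic c (X \<inter> W U)"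
        "\<forall>X\<in>(\<Union>j\<in>T. F j). X \<inter> W U \<noteq> {} \<longrightarrow> (\<exists>x\<in>X \<inter> W U. c x \<noteq> 2)"
        using three_colouring[OF finW[of U] inj_on_subset[OF f(3) WR] ABA_free_mono[OF f(4) WR order_refl]
            ABA_free_mono[OF f(5) WR order_refl]] by (elim exE conjE)
      show ?thesis
      proof (intro exI[of _ c] conjI ballI impI c(1))
        show "bichromatic c (X \<inter> W U)" if "j \<in> U" "X \<in> F j" "card (X \<inter> W U) \<ge> 12" for j X
          using bspec[OF c(2), of X] that f(1) by blast
        show "\<exists>x\<in>X \<inter> W U. c x \<noteq> 2" if "i \<in> U" "X \<in> F i" "X \<inter> W U \<noteq> {}" for X
          using bspec[OF c(3), of X] that f(2) by blast
      qed
    qed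
    then obtain c :: "'i set \<Rightarrow> 'a \<Rightarrow> nat" where c: "\<And>U x. c U x < 3"
      "\<And>U j X. j \<in> U \<Longrightarrow> X \<in> F j \<Longrightarrow> card (X \<inter> W U) \<ge> 12 \<Longrightarrow> bichromatic (c U) (X \<inter> W U)"
      "\<And>U X. i \<in> U \<Longrightarrow> X \<in> F i \<Longrightarrow> X \<inter> W U \<noteq> {} \<Longrightarrow> \<exists>x\<in>X \<inter> W U. c U x \<noteq> 2"
      by metis
    define e where "e x = (if x \<in> S then d x else c (u x) x)" for x
    have eW: "e x = c U x" if "x \<in> W U" for x U using that by (auto simp: e_def W_def)
    have dom: "bichromatic e (X \<inter> S)" if p: "p \<in> X" "dominated (L j) S d p" and X: "X \<in> F j" for X j p
    proof -
      obtain x y where "x \<in> S" "y \<in> S" "d x \<noteq> d y" "L j p x" "L j p y" using p(2) unfolding dominated_def by blast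
      moreover from this have "x \<in> X" "y \<in> X" using X p(1) unfolding L_def below_def by blast+
      ultimately show ?thesis unfolding bichromatic_def e_def by (intro bexI[of _ x] bexI[of _ y]) auto
    qed
    have ncol: "\<exists>x\<in>X \<inter> S. e x \<noteq> 2" if XS: "X \<inter> S \<noteq> {}" for X
    proof -
      obtain x where "x \<in> X" "x \<in> S" using XS by blast
      moreover from this have "e x \<noteq> 2" using S(3)[THEN spec, of x] by (simp add: e_def)
      ultimately show ?thesis by blast
    qed
    show "\<exists>c::'a \<Rightarrow> nat. (\<forall>x. c x < 3) \<and> (\<forall>j\<in>J. \<forall>X\<in>F j. card (X \<inter> R) > M \<longrightarrow> bichromatic c (X \<inter> R)) \<and>
       (\<forall>X\<in>F i. X \<inter> R \<noteq> {} \<longrightarrow> (\<exists>x\<in>X \<inter> R. c x \<noteq> 2))"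
    proof (intro exI[of _ e] conjI allI ballI impI)
      show "e x < 3" for x using c(1)[of "u x" x] S(3)[THEN spec, of x] by (simp add: e_def)
      show "bichromatic e (X \<inter> R)" if j: "j \<in> J" and X: "X \<in> F j" and big: "card (X \<inter> R) > M" for j X
      proof -
        have "\<exists>U\<in>Pow J. card (X \<inter> W U) \<ge> 12"
        proof (rule ccontr)
          assume "\<not> ?thesis"
          then have small: "card (X \<inter> W U) \<le> 12" if "U \<in> Pow J" for U
            using that by (meson linorder_le_cases)
          have "x \<in> W (u x)" "u x \<in> Pow J" if "x \<in> R" "x \<notin> S" for x
            using that by (simp_all add: W_def u_def)
          then have "X \<inter> R \<subseteq> S \<union> (\<Union>U\<in>Pow J. X \<inter> W U)" by blast
          then have "card (X \<inter> R) \<le> card (S \<union> (\<Union>U\<in>Pow J. X \<inter> W U))"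
            using J fin S(1) finW by (intro card_mono finite_UnI finite_UN_I finite_Int finite_subset[OF S(1)]) simp_all
          also have "\<dots> \<le> card S + card (\<Union>U\<in>Pow J. X \<inter> W U)" by (rule card_Un_le)
          also have "card (\<Union>U\<in>Pow J. X \<inter> W U) \<le> (\<Sum>U\<in>Pow J. card (X \<inter> W U))"
            using J by (intro card_UN_le) simp
          also have "\<dots> \<le> card (Pow J) * 12" using sum_bounded_above[of "Pow J" "\<lambda>U. card (X \<inter> W U)" 12] small by simp
          finally have "card (X \<inter> R) \<le> card S + card (Pow J) * 12" by simp
          moreover have "card S \<le> N * card (J \<times> J)" using S(2) cardK by (meson le_trans mult_le_mono2)
          ultimately show False using big unfolding M_def by linarith
        qed
        then obtain U where U: "card (X \<inter> W U) \<ge> 12" by blast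
        show ?thesis
        proof (cases "j \<in> U")
          case True
          have "bichromatic e (X \<inter> W U) = bichromatic (c U) (X \<inter> W U)"
            by (rule bichromatic_cong) (simp add: eW)
          then have "bichromatic e (X \<inter> W U)" using c(2)[OF True X U] by simp
          then show ?thesis by (rule bichromatic_mono) (auto simp: W_def)
        next
          case False
          have "X \<inter> W U \<noteq> {}" using U by auto
          then obtain p where "p \<in> X" "p \<in> W U" by blast
          then have "dominated (L j) S d p" using False j by (auto simp: W_def u_def)
          from dom[OF \<open>p \<in> X\<close> this X] show ?thesis by (rule bichromatic_mono) (use S in auto)
        qed
      qed
      show "\<exists>x\<in>X \<inter> R. e x \<noteq> 2" if X: "X \<in> F i" and ne: "X \<inter> R \<noteq> {}" for X
      proof (cases "X \<inter> S = {}")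
        case False then show ?thesis using ncol[OF False] S(1) by blast
      next
        case True
        then obtain p where p: "p \<in> X" "p \<in> W (u p)" using ne by (auto simp: W_def)
        \<comment> \<open>A member of \<open>F i\<close> missing \<open>S\<close> contains no point
          dominated for \<open>i\<close>, so the clause about colour 2 is available in the class of
          \<open>p\<close>.\<close>
        have "i \<in> u p"
        proof (rule ccontr)
          assume "i \<notin> u p"
          then have "dominated (L i) S d p" using i by (simp add: u_def)
          from dom[OF p(1) this X] show False using True by (simp add: bichromatic_def)
        qed
        then obtain x where "x \<in> X \<inter> W (u p)" "c (u p) x \<noteq> 2" using c(3)[of "u p" X] X p by blast
        then show ?thesis using eW[of x "u p"] by (intro bexI[of _ x]) (auto simp: W_def)
      qed
    qed
  qed
qed

text \<open>The invariant: a member of a treated family with points outside the union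
  \<open>A\<close> of the layers has a point of colour 0 or 1 in \<open>A\<close>. In the end
  everything outside \<open>A\<close> receives colour 2, so such members are bichromatic; the traces
  of the others lie in \<open>A\<close>, where some layer holds more than \<open>M\<close> of their
  points.\<close>

lemma layered_colouring:
  fixes J :: "'i set"
  assumes J: "finite J"
  shows "\<exists>M. \<forall>(V::'a set) F. finite V \<longrightarrow>
     (\<forall>i\<in>J. \<forall>R\<subseteq>V. (\<forall>x\<in>R. \<forall>y\<in>R. x \<noteq> y \<longrightarrow> \<not> below (F i) x y) \<longrightarrow> two_sided F J i R) \<longrightarrow>
     (\<exists>c::'a \<Rightarrow> nat. (\<forall>x. c x < 3) \<and> (\<forall>j\<in>J. \<forall>X\<in>F j. card (X \<inter> V) > M \<longrightarrow> bichromatic c (X \<inter> V)))"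
proof -
  obtain M where M: "\<forall>(R::'a set) F. \<forall>i\<in>J. finite R \<longrightarrow> two_sided F J i R \<longrightarrow>
     (\<exists>c::'a \<Rightarrow> nat. (\<forall>x. c x < 3) \<and> (\<forall>j\<in>J. \<forall>X\<in>F j. card (X \<inter> R) > M \<longrightarrow> bichromatic c (X \<inter> R)) \<and>
       (\<forall>X\<in>F i. X \<inter> R \<noteq> {} \<longrightarrow> (\<exists>x\<in>X \<inter> R. c x \<noteq> 2)))"
    by (rule exE[OF antichain_colouring[OF J]])
  show ?thesis
  proof (intro exI[of _ "M * card J"] allI impI)
    fix V :: "'a set" and F
    assume fin: "finite V" and ts: "\<forall>i\<in>J. \<forall>R\<subseteq>V. (\<forall>x\<in>R. \<forall>y\<in>R. x \<noteq> y \<longrightarrow> \<not> below (F i) x y) \<longrightarrow> two_sided F J i R"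
    have "\<exists>A\<subseteq>V. \<exists>c::'a \<Rightarrow> nat. (\<forall>x. c x < 3) \<and> (\<forall>j\<in>J. \<forall>X\<in>F j. card (X \<inter> A) > M * card I \<longrightarrow> bichromatic c (X \<inter> A)) \<and>
        (\<forall>i\<in>I. \<forall>X\<in>F i. X \<inter> (V - A) \<noteq> {} \<longrightarrow> (\<exists>x\<in>X \<inter> A. c x \<noteq> 2))"
      if "finite I" "I \<subseteq> J" for I
      using that
    proof (induction I rule: finite_induct)
      case empty
      show ?case by (intro exI[of _ "{}"] conjI exI[of _ "\<lambda>_. 0"]) auto
    next
      case (insert i I)
      then have i: "i \<in> J" "I \<subseteq> J" by auto
      obtain A c where A: "A \<subseteq> V" "\<forall>x. c x < (3::nat)"
        "\<forall>j\<in>J. \<forall>X\<in>F j. card (X \<inter> A) > M * card I \<longrightarrow> bichromatic c (X \<inter> A)"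
        "\<forall>i\<in>I. \<forall>X\<in>F i. X \<inter> (V - A) \<noteq> {} \<longrightarrow> (\<exists>x\<in>X \<inter> A. c x \<noteq> 2)"
        using insert.IH[OF i(2)] by (elim exE conjE)
      have "\<exists>R\<subseteq>V - A. (\<forall>X\<in>{X\<in>F i. X \<inter> (V - A) \<noteq> {}}. X \<inter> R \<noteq> {}) \<and> (\<forall>r\<in>R. \<exists>X\<in>{X\<in>F i. X \<inter> (V - A) \<noteq> {}}. X \<inter> R = {r})"
        by (rule minimal_hitting_set[OF finite_Diff[OF fin]]) simp
      then obtain R where R: "R \<subseteq> V - A" "\<forall>X\<in>{X\<in>F i. X \<inter> (V - A) \<noteq> {}}. X \<inter> R \<noteq> {}"
        "\<forall>r\<in>R. \<exists>X\<in>{X\<in>F i. X \<inter> (V - A) \<noteq> {}}. X \<inter> R = {r}" by (elim exE conjE)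
      have RV: "R \<subseteq> V" using R(1) by blast
      then have finR: "finite R" using fin finite_subset by blast
      have "\<forall>x\<in>R. \<forall>y\<in>R. x \<noteq> y \<longrightarrow> \<not> below (F i) x y"
      proof (intro ballI impI)
        fix x y assume xy: "x \<in> R" "y \<in> R" "x \<noteq> y"
        obtain X where X: "X \<in> F i" "X \<inter> R = {x}" using bspec[OF R(3) xy(1)] by auto
        have "x \<in> X" using X(2) by blast
        moreover have "y \<notin> X" using X(2) xy IntI[of y X R] by (metis singletonD)
        ultimately show "\<not> below (F i) x y" using X(1) unfolding below_def by blast
      qed
      then have tsR: "two_sided F J i R" using ts i(1) RV by blast
      obtain d where d: "\<forall>x. d x < (3::nat)" "\<forall>j\<in>J. \<forall>X\<in>F j. card (X \<inter> R) > M \<longrightarrow> bichromatic d (X \<inter> R)"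
        "\<forall>X\<in>F i. X \<inter> R \<noteq> {} \<longrightarrow> (\<exists>x\<in>X \<inter> R. d x \<noteq> 2)"
        using M[THEN spec, THEN spec, THEN bspec, THEN mp, THEN mp, OF i(1) finR tsR] by (elim exE conjE)
      define e where "e x = (if x \<in> R then d x else c x)" for x
      have eA: "e x = c x" if "x \<in> A" for x using that R(1) by (auto simp: e_def)
      show ?case
      proof (intro exI[of _ "A \<union> R"] exI[of _ e] conjI ballI allI impI)
        show "A \<union> R \<subseteq> V" using A(1) RV by blast
        show "e x < 3" for x using A(2) d(1) by (simp add: e_def)
        show "bichromatic e (X \<inter> (A \<union> R))" if j: "j \<in> J" and X: "X \<in> F j" and big: "card (X \<inter> (A \<union> R)) > M * card (insert i I)" for j X
        proof -
          have "card (X \<inter> (A \<union> R)) \<le> card (X \<inter> A) + card (X \<inter> R)"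
            using card_Un_le[of "X \<inter> A" "X \<inter> R"] by (simp add: Int_Un_distrib)
          moreover have "M * card (insert i I) = M * card I + M" using insert.hyps by simp
          ultimately consider "card (X \<inter> A) > M * card I" | "card (X \<inter> R) > M" using big by linarith
          then show ?thesis
          proof cases
            case 1
            have "bichromatic e (X \<inter> A) = bichromatic c (X \<inter> A)" by (rule bichromatic_cong) (simp add: eA)
            then have "bichromatic e (X \<inter> A)" using A(3) j X 1 by blast
            then show ?thesis by (rule bichromatic_mono) blast
          next
            case 2
            have "bichromatic e (X \<inter> R) = bichromatic d (X \<inter> R)" by (rule bichromatic_cong) (simp add: e_def)
            then have "bichromatic e (X \<inter> R)" using d(2) j X 2 by blast
            then show ?thesis by (rule bichromatic_mono) blast
          qed
        qed
        show "\<exists>x\<in>X \<inter> (A \<union> R). e x \<noteq> 2" if k: "k \<in> insert i I" and X: "X \<in> F k" and ne: "X \<inter> (V - (A \<union> R)) \<noteq> {}" for k X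
        proof (cases "k = i")
          case True
          have "X \<inter> R \<noteq> {}" using bspec[OF R(2), of X] X True ne by blast
          then obtain x where "x \<in> X \<inter> R" "d x \<noteq> 2" using d(3) X True by blast
          then show ?thesis by (intro bexI[of _ x]) (auto simp: e_def)
        next
          case False
          then obtain x where "x \<in> X \<inter> A" "c x \<noteq> 2" using A(4) k X ne by blast
          then show ?thesis using eA[of x] by (intro bexI[of _ x]) auto
        qed
      qed
    qed
    from this[OF J order_refl] obtain A c where A: "A \<subseteq> V" "\<forall>x. c x < (3::nat)"
        "\<forall>j\<in>J. \<forall>X\<in>F j. card (X \<inter> A) > M * card J \<longrightarrow> bichromatic c (X \<inter> A)"
        "\<forall>i\<in>J. \<forall>X\<in>F i. X \<inter> (V - A) \<noteq> {} \<longrightarrow> (\<exists>x\<in>X \<inter> A. c x \<noteq> 2)" by (elim exE conjE)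
    define e where "e x = (if x \<in> A then c x else 2)" for x
    show "\<exists>c::'a \<Rightarrow> nat. (\<forall>x. c x < 3) \<and> (\<forall>j\<in>J. \<forall>X\<in>F j. card (X \<inter> V) > M * card J \<longrightarrow> bichromatic c (X \<inter> V))"
    proof (intro exI[of _ e] conjI allI ballI impI)
      show "e x < 3" for x using A(2) by (simp add: e_def)
      show "bichromatic e (X \<inter> V)" if j: "j \<in> J" and X: "X \<in> F j" and big: "card (X \<inter> V) > M * card J" for j X
      proof (cases "X \<inter> (V - A) = {}")
        case True
        then have "X \<inter> V = X \<inter> A" using A(1) by blast
        moreover have "bichromatic e (X \<inter> A) = bichromatic c (X \<inter> A)" by (rule bichromatic_cong) (simp add: e_def)
        ultimately show ?thesis using A(3) j X big by simp
      next
        case False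
        then obtain x where x: "x \<in> X \<inter> A" "c x \<noteq> 2" using A(4) j X by blast
        obtain y where y: "y \<in> X \<inter> (V - A)" using False by blast
        have "e x \<noteq> e y" using x y by (simp add: e_def)
        then show ?thesis unfolding bichromatic_def using x y A(1) by (intro bexI[of _ x] bexI[of _ y]) auto
      qed
    qed
  qed
qed

section \<open>Translates of a planar convex body\<close>

definition cross2 :: "real^2 \<Rightarrow> real^2 \<Rightarrow> real" where
  "cross2 x y = x $ 1 * y $ 2 - x $ 2 * y $ 1"

lemma cross2_simps:
  "cross2 x (y + z) = cross2 x y + cross2 x z" "cross2 (x + y) z = cross2 x z + cross2 y z"
  "cross2 x (y - z) = cross2 x y - cross2 x z" "cross2 (x - y) z = cross2 x z - cross2 y z"
  "cross2 x (- y) = - cross2 x y" "cross2 (- x) y = - cross2 x y"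
  "cross2 x (k *\<^sub>R y) = k * cross2 x y" "cross2 (k *\<^sub>R x) y = k * cross2 x y"
  "cross2 x x = 0" "cross2 x 0 = 0" "cross2 0 x = 0"
  by (simp_all add: cross2_def algebra_simps)

lemma cross2_commute: "cross2 x y = - cross2 y x"
  by (simp add: cross2_def)

lemma vec2_eq_iff: "(x::real^2) = y \<longleftrightarrow> x $ 1 = y $ 1 \<and> x $ 2 = y $ 2"
  by (simp add: vec_eq_iff forall_2)

text \<open>The linear dependence of three plane vectors. If \<open>g\<close> and \<open>h\<close>
  lie on different sides of \<open>d\<close>, one sign of this identity is a conic combination, so a
  convex cone containing both contains a multiple of \<open>d\<close>.\<close>

lemma cross2_eliminate: "cross2 d g *\<^sub>R h - cross2 d h *\<^sub>R g = cross2 h g *\<^sub>R d"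
  by (simp add: cross2_def vec2_eq_iff algebra_simps)

lemma cross2_eq_0D:
  assumes "cross2 x y = 0" "x \<noteq> 0"
  shows "\<exists>k. y = k *\<^sub>R x"
proof (cases "x $ 1 = 0")
  case True
  then have "x $ 2 \<noteq> 0" using assms(2) by (simp add: vec2_eq_iff)
  then show ?thesis using assms(1) True
    by (intro exI[of _ "y $ 2 / x $ 2"]) (auto simp: cross2_def vec2_eq_iff)
next
  case False
  then show ?thesis using assms(1)
    by (intro exI[of _ "y $ 1 / x $ 1"]) (auto simp: cross2_def vec2_eq_iff field_simps)
qed

lemma inner_vec2: "(x::real^2) \<bullet> y = x $ 1 * y $ 1 + x $ 2 * y $ 2"
  by (simp add: inner_vec_def sum_2)

lemma orthogonal_to_common_parallel:
  assumes "(a::real^2) \<noteq> 0" "f \<noteq> 0" "a \<bullet> f = 0" "a \<bullet> z = 0"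
  shows "\<exists>k. z = k *\<^sub>R f"
proof -
  have "a $ 1 * cross2 f z = 0" "a $ 2 * cross2 f z = 0"
    using assms(3,4) unfolding inner_vec2 cross2_def by algebra+
  then have "cross2 f z = 0" using assms(1) by (auto simp: vec2_eq_iff)
  then show ?thesis using cross2_eq_0D assms(2) by blast
qed

text \<open>A uniform version of the cone of feasible directions: one direction must work at all
  points of \<open>C\<close> near \<open>p\<close>, while the step length may depend on the
  point.\<close>

definition feasible :: "'a::euclidean_space set \<Rightarrow> 'a \<Rightarrow> real \<Rightarrow> 'a set" where
  "feasible C p r = {d. \<forall>u\<in>C \<inter> ball p r. \<exists>s>0. u + s *\<^sub>R d \<in> C}"

lemma feasible_antimono: "r' \<le> r \<Longrightarrow> feasible C p r \<subseteq> feasible C p r'"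
  unfolding feasible_def by auto

lemma zero_feasible: "0 \<in> feasible C p r"
  unfolding feasible_def by (auto intro: exI[of _ 1])

lemma scaleR_feasible:
  assumes "d \<in> feasible C p r" "k \<ge> 0"
  shows "k *\<^sub>R d \<in> feasible C p r"
proof (cases "k = 0")
  case False
  show ?thesis unfolding feasible_def
  proof (intro CollectI ballI)
    fix u assume "u \<in> C \<inter> ball p r"
    then obtain s where "s > 0" "u + s *\<^sub>R d \<in> C" using assms unfolding feasible_def by blast
    then show "\<exists>s>0. u + s *\<^sub>R k *\<^sub>R d \<in> C" using assms(2) False by (intro exI[of _ "s / k"]) auto
  qed
qed (simp add: zero_feasible)

lemma convex_shorten:
  assumes "convex C" "u \<in> C" "u + s *\<^sub>R d \<in> C" "0 \<le> t" "t \<le> (s::real)"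
  shows "u + t *\<^sub>R d \<in> C"
proof (cases "s = 0")
  case False
  then have "u + t *\<^sub>R d = (1 - t / s) *\<^sub>R u + (t / s) *\<^sub>R (u + s *\<^sub>R d)"
    by (simp add: algebra_simps)
  also have "\<dots> \<in> C" using assms False by (intro convexD) auto
  finally show ?thesis .
qed (use assms in auto)

lemma add_feasible:
  assumes "convex C" "d \<in> feasible C p r" "e \<in> feasible C p r"
  shows "d + e \<in> feasible C p r"
  unfolding feasible_def
proof (intro CollectI ballI)
  fix u assume u: "u \<in> C \<inter> ball p r"
  obtain s where s: "s > 0" "u + s *\<^sub>R d \<in> C" using u assms(2) unfolding feasible_def by blast
  obtain t where t: "t > 0" "u + t *\<^sub>R e \<in> C" using u assms(3) unfolding feasible_def by blast
  let ?m = "min s t"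
  have "u + ?m *\<^sub>R d \<in> C" "u + ?m *\<^sub>R e \<in> C"
    using convex_shorten[OF assms(1) _ s(2), of ?m] convex_shorten[OF assms(1) _ t(2), of ?m] u s(1) t(1) by auto
  then have "(1/2) *\<^sub>R (u + ?m *\<^sub>R d) + (1/2) *\<^sub>R (u + ?m *\<^sub>R e) \<in> C"
    using assms(1) by (intro convexD) auto
  moreover have "(1/2) *\<^sub>R (u + ?m *\<^sub>R d) + (1/2) *\<^sub>R (u + ?m *\<^sub>R e) = ((1/2) *\<^sub>R u + (1/2) *\<^sub>R u) + (?m / 2) *\<^sub>R (d + e)"
    by (simp add: algebra_simps)
  moreover have "(1/2) *\<^sub>R u + (1/2) *\<^sub>R u = u" by (simp flip: scaleR_add_left)
  ultimately show "\<exists>s>0. u + s *\<^sub>R (d + e) \<in> C" using s(1) t(1) by (intro exI[of _ "?m / 2"]) auto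
qed

text \<open>Local feasibility near \<open>p\<close> controls translations from arbitrary points of \<open>C\<close>: the nearest point of
  \<open>C\<close> to a violating point would lie in the ball, and its normal would make an obtuse angle with \<open>d\<close>.\<close>

lemma feasible_stays:
  assumes "convex C" "closed C" "p \<in> C" "d \<in> feasible C p r" "z \<in> C" "z + d \<in> ball p r"
  shows "z + d \<in> C"
proof (rule ccontr)
  assume not: "z + d \<notin> C"
  define w where "w = closest_point C (z + d)"
  have wC: "w \<in> C" using assms(2,3) unfolding w_def by (intro closest_point_in_set) auto
  have "dist w p \<le> dist (z + d) p"
    using closest_point_lipschitz[OF assms(1,2), of "z + d" p] assms(3) closest_point_self[OF assms(3)] unfolding w_def by auto
  then have "w \<in> ball p r" using assms(6) by (simp add: dist_commute)
  then obtain s where s: "s > 0" "w + s *\<^sub>R d \<in> C" using assms(4) wC unfolding feasible_def by blast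
  have 1: "(z + d - w) \<bullet> (z - w) \<le> 0" using closest_point_dot[OF assms(1,2,5)] unfolding w_def .
  have "(z + d - w) \<bullet> (w + s *\<^sub>R d - w) \<le> 0" using closest_point_dot[OF assms(1,2) s(2)] unfolding w_def .
  then have "(z + d - w) \<bullet> d \<le> 0" using s(1) by (simp add: mult_le_0_iff)
  then have "(z + d - w) \<bullet> (z + d - w) \<le> 0" using 1 by (simp add: algebra_simps)
  then have "z + d = w" using inner_ge_zero[of "z + d - w"] by (metis antisym eq_iff_diff_eq_0 inner_eq_zero_iff)
  then show False using not wC by simp
qed

text \<open>Vectors of \<open>K\<close> strictly on both sides of \<open>d\<close> combine to a
  multiple of \<open>d\<close>. Only the zero multiple is in \<open>K\<close>, so the two are
  opposite and \<open>K\<close> contains a line. A vector off this line, from \<open>full\<close>,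
  makes \<open>K\<close> contain a half-plane, and with it \<open>d\<close> or
  \<open>- d\<close>.\<close>

lemma cone_one_side:
  fixes K :: "(real^2) set"
  assumes add: "\<And>x y. x \<in> K \<Longrightarrow> y \<in> K \<Longrightarrow> x + y \<in> K"
    and scale: "\<And>k x. k \<ge> 0 \<Longrightarrow> x \<in> K \<Longrightarrow> k *\<^sub>R x \<in> K"
    and full: "\<And>g. g \<noteq> 0 \<Longrightarrow> \<exists>w\<in>K. cross2 g w \<noteq> 0"
    and d: "d \<notin> K" "- d \<notin> K" and gh: "g \<in> K" "g \<noteq> 0" "h \<in> K" "h \<noteq> 0"
  shows "cross2 d g * cross2 d h > 0"
proof -
  have d0: "d \<noteq> 0" using scale[of 0 g] gh d by auto
  have line: "k = 0" if k: "k *\<^sub>R d \<in> K" for k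
  proof (rule ccontr)
    assume "k \<noteq> 0"
    then have "(1 / \<bar>k\<bar>) *\<^sub>R k *\<^sub>R d = d \<or> (1 / \<bar>k\<bar>) *\<^sub>R k *\<^sub>R d = - d" by (cases "k > 0") auto
    then show False using scale[OF _ k, of "1 / \<bar>k\<bar>"] d by auto
  qed
  have nz: "cross2 d x \<noteq> 0" if "x \<in> K" "x \<noteq> 0" for x
    using cross2_eq_0D[OF _ d0, of x] line that by (metis scaleR_zero_left)
  have "\<not> (cross2 d x > 0 \<and> cross2 d y < 0)" if xy: "x \<in> K" "y \<in> K" for x y
  proof
    assume s: "cross2 d x > 0 \<and> cross2 d y < 0"
    have "cross2 d x *\<^sub>R y + (- cross2 d y) *\<^sub>R x \<in> K" using xy s by (intro add scale) auto
    then have "cross2 y x *\<^sub>R d \<in> K" using cross2_eliminate[of d x y] by simp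
    then have "cross2 y x = 0" using line by blast
    moreover have "y \<noteq> 0" "x \<noteq> 0" using s by (auto simp: cross2_simps)
    ultimately obtain k where k: "x = k *\<^sub>R y" using cross2_eq_0D by blast
    have "k < 0" using s k by (auto simp: cross2_simps zero_less_mult_iff)
    have "(1 / - k) *\<^sub>R x \<in> K" using \<open>k < 0\<close> xy by (intro scale) auto
    then have ny: "- y \<in> K" using k \<open>k < 0\<close> by simp
    then have yl: "t *\<^sub>R y \<in> K" for t
      using scale[of t y] scale[of "- t" "- y"] xy by (cases "t \<ge> 0") auto
    obtain w where w: "w \<in> K" "cross2 y w \<noteq> 0" using full[OF \<open>y \<noteq> 0\<close>] by blast
    have "d = (1 / cross2 y w) *\<^sub>R (cross2 d w *\<^sub>R y - cross2 d y *\<^sub>R w)"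
      using cross2_eliminate[of d w y] w(2) by simp
    then have dd: "d = (cross2 d w / cross2 y w) *\<^sub>R y + (- cross2 d y / cross2 y w) *\<^sub>R w"
      by (simp add: algebra_simps)
    show False
    proof (cases "- cross2 d y / cross2 y w \<ge> 0")
      case True then show False using dd add[OF yl scale[OF True w(1)]] d by metis
    next
      case False
      then have "(cross2 d y / cross2 y w) *\<^sub>R w \<in> K" using scale w(1) by simp
      moreover have "- d = (- (cross2 d w / cross2 y w)) *\<^sub>R y + (cross2 d y / cross2 y w) *\<^sub>R w"
        by (subst dd) (simp add: algebra_simps)
      ultimately show False using add yl d(2) by metis
    qed
  qed
  then show ?thesis using nz[OF gh(1,2)] nz[OF gh(3,4)] gh
    by (metis linorder_neqE_linordered_idom mult_neg_neg mult_pos_pos)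
qed

text \<open>Two translates of a convex set, both directed upwards by \<open>\<nu>\<close>, cross at most once: the parallelogram
  \<open>a - v, b - v, a - v', b - v'\<close> has one diagonal in \<open>C\<close>, and one of its other two vertices lies above it.\<close>

lemma translates_cross_once:
  fixes C :: "(real^2) set"
  assumes C: "convex C" and \<nu>: "\<nu> \<noteq> 0"
    and a: "a - v \<in> C" "a - v' \<notin> C" "a - v' + \<nu> \<in> C"
    and b: "b - v' \<in> C" "b - v \<notin> C" "b - v + \<nu> \<in> C"
  shows "cross2 \<nu> (b - a) * cross2 \<nu> (v - v') < 0"
proof (rule ccontr)
  assume "\<not> ?thesis"
  then have pos: "cross2 \<nu> (b - a) * cross2 \<nu> (v - v') \<ge> 0" by simp
  define \<alpha> \<beta> where "\<alpha> = cross2 \<nu> (b - a)" and "\<beta> = cross2 \<nu> (v - v')"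
  define \<theta> where "\<theta> = (if \<alpha> + \<beta> = 0 then 0 else \<alpha> / (\<alpha> + \<beta>))"
  have ab: "(\<alpha> \<ge> 0 \<and> \<beta> \<ge> 0) \<or> (\<alpha> \<le> 0 \<and> \<beta> \<le> 0)"
    using pos by (auto simp: \<alpha>_def \<beta>_def zero_le_mult_iff)
  then have \<theta>: "0 \<le> \<theta>" "\<theta> \<le> 1" and \<theta>\<alpha>: "\<theta> * (\<alpha> + \<beta>) = \<alpha>"
    by (auto simp: \<theta>_def divide_simps)
  define A B where "A = a - v" and "B = b - v'"
  define S where "S = (1 - \<theta>) *\<^sub>R A + \<theta> *\<^sub>R B"
  define T where "T = \<theta> *\<^sub>R A + (1 - \<theta>) *\<^sub>R B"
  have ST: "S \<in> C" "T \<in> C" using C a b \<theta> unfolding S_def T_def A_def B_def by (auto intro: convexD)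
  have "b - v - S = (b - a) - \<theta> *\<^sub>R ((b - a) + (v - v'))" unfolding S_def A_def B_def by (simp add: algebra_simps)
  then have "cross2 \<nu> (b - v - S) = \<alpha> - \<theta> * (\<alpha> + \<beta>)" by (simp only: cross2_simps \<alpha>_def \<beta>_def)
  then obtain k where k: "b - v - S = k *\<^sub>R \<nu>" using cross2_eq_0D[OF _ \<nu>] \<theta>\<alpha> by force
  have "S + T = A + B" unfolding S_def T_def by (simp add: algebra_simps)
  then have "a - v' - T = - (b - v - S)" unfolding A_def B_def by (simp add: algebra_simps)
  then have k': "a - v' - T = (- k) *\<^sub>R \<nu>" using k by simp
  show False
  proof (cases "k \<ge> 0")
    case True
    have "S + (k + 1) *\<^sub>R \<nu> \<in> C" using k b(3) by (simp add: algebra_simps)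
    then have "S + k *\<^sub>R \<nu> \<in> C" using convex_shorten[OF C ST(1)] True by simp
    then show False using k b(2) by (metis add_diff_cancel_left' add_diff_eq diff_add_cancel)
  next
    case False
    have "T + (- k + 1) *\<^sub>R \<nu> = (a - v' - T) + T + \<nu>" unfolding k' by (simp add: algebra_simps)
    then have "T + (- k + 1) *\<^sub>R \<nu> \<in> C" using a(3) by simp
    then have "T + (- k) *\<^sub>R \<nu> \<in> C" using convex_shorten[OF C ST(2), of "- k + 1" \<nu> "- k"] False by simp
    then show False using k' a(2) by (metis add_diff_cancel_left' add_diff_eq diff_add_cancel)
  qed
qed

text \<open>The radius \<open>\<rho>\<close> pays for the offset of \<open>q\<close> from
  \<open>p\<close>, for the size of the ball and for the displacement of the target
  \<open>c'\<close>.\<close>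

lemma inball_shift:
  fixes c :: "'a::euclidean_space"
  assumes "cball c \<rho> \<subseteq> C" "u \<in> ball p r" "dist p q + r + dist c c' \<le> \<rho>"
  shows "u + (c' - q) \<in> C"
proof -
  have "norm ((u - p) + (p - q) + (c' - c)) \<le> norm (u - p) + norm (p - q) + norm (c' - c)"
    using norm_triangle_ineq[of "(u - p) + (p - q)" "c' - c"] norm_triangle_ineq[of "u - p" "p - q"] by linarith
  also have "\<dots> \<le> \<rho>" using assms(2,3) by (simp add: dist_norm norm_minus_commute)
  finally have "u + (c' - q) \<in> cball c \<rho>" by (simp add: dist_norm norm_minus_commute algebra_simps)
  then show ?thesis using assms(1) by blast
qed

lemma inball_feasible:
  fixes c :: "'a::euclidean_space"
  assumes "cball c \<rho> \<subseteq> C" "dist p q + r + dist c c' \<le> \<rho>"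
  shows "c' - q \<in> feasible C p r"
  unfolding feasible_def using inball_shift[OF assms(1) _ assms(2)] by (auto intro!: exI[of _ 1])

text \<open>A line separating the midpoint from the interior contains both ends, as the midpoint is
  their mean. The inball keeps \<open>c\<close> at distance at least \<open>\<rho>\<close> from
  it.\<close>

lemma supporting_line_through_chord:
  fixes C :: "'a::euclidean_space set"
  assumes C: "convex C" "cball c \<rho> \<subseteq> C" "\<rho> > 0" and pq: "p \<in> C" "q \<in> C" "midpoint p q \<notin> interior C"
  obtains a where "a \<noteq> 0" "a \<bullet> p = a \<bullet> q" "\<And>x. x \<in> C \<Longrightarrow> a \<bullet> x \<le> a \<bullet> p" "a \<bullet> (p - c) \<ge> \<rho> * norm a"
proof -
  have ne: "interior C \<noteq> {}" using C(2,3) by (metis ball_subset_cball centre_in_ball empty_iff interior_maximal open_ball order_trans subsetD)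
  obtain a b where ab: "a \<noteq> 0" "\<forall>x\<in>interior C. a \<bullet> x \<le> b" "\<forall>x\<in>{midpoint p q}. a \<bullet> x \<ge> b"
    using separating_hyperplane_sets[of "interior C" "{midpoint p q}"] C(1) ne pq(3) by (auto intro: convex_interior)
  have "closed {x. a \<bullet> x \<le> b}" by (rule closed_halfspace_le)
  moreover have "interior C \<subseteq> {x. a \<bullet> x \<le> b}" using ab(2) by auto
  ultimately have "closure (interior C) \<subseteq> {x. a \<bullet> x \<le> b}" by (rule closure_minimal[rotated])
  then have le: "a \<bullet> x \<le> b" if "x \<in> C" for x
    using that convex_closure_interior[OF C(1) ne] closure_subset by blast
  have "a \<bullet> midpoint p q = (a \<bullet> p + a \<bullet> q) / 2" by (simp add: midpoint_def inner_add_right)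
  then have eq: "a \<bullet> p = b" "a \<bullet> q = b" using ab(3) le[OF pq(1)] le[OF pq(2)] by auto
  have "c + (\<rho> / norm a) *\<^sub>R a \<in> C" using C(2,3) ab(1) by (auto simp: dist_norm)
  from le[OF this] have "a \<bullet> c + \<rho> * norm a \<le> a \<bullet> p"
    using ab(1) eq by (simp add: inner_add_right power2_norm_eq_inner[symmetric] power2_eq_square)
  then show thesis using that[of a] ab(1) eq le by (simp add: inner_diff_right)
qed

lemma positive_multiple:
  assumes "(a::real^2) \<noteq> 0" "f \<noteq> 0" "a \<bullet> f = 0" "a \<bullet> z = 0" "norm (z - f) < norm f"
  shows "\<exists>k>0. z = k *\<^sub>R f"
proof -
  obtain k where k: "z = k *\<^sub>R f" using orthogonal_to_common_parallel[OF assms(1-4)] by blast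
  have "z - f = (k - 1) *\<^sub>R f" using k by (simp add: algebra_simps)
  then have "\<bar>k - 1\<bar> * norm f < norm f" using assms(5) by simp
  then have "\<bar>k - 1\<bar> < 1" using assms(2) by simp
  then show ?thesis using k by (intro exI[of _ k]) auto
qed

text \<open>If the midpoint is interior, half of the translation already leads into a ball inside
  \<open>C\<close>. Otherwise the chord lies on a supporting line; depths below it are measured in
  units of the depth \<open>H\<close> of \<open>c\<close>, and a small depth is compensated by a
  small move towards \<open>c\<close>.\<close>

lemma feasible_chord_local:
  fixes C :: "(real^2) set"
  assumes C: "convex C" "cball c \<rho> \<subseteq> C" "\<rho> > 0" and pq: "p \<in> C" "q \<in> C" "p \<noteq> q"
  shows "\<exists>e>0. \<forall>q'\<in>C \<inter> ball q e. q' - p \<in> feasible C p e"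
proof (cases "midpoint p q \<in> interior C")
  case True
  then obtain e where e: "e > 0" "ball (midpoint p q) e \<subseteq> C" using mem_interior by blast
  have "q' - p \<in> feasible C p (e / 2)" if q': "q' \<in> C \<inter> ball q (e / 2)" for q'
    unfolding feasible_def
  proof (intro CollectI ballI)
    fix u assume u: "u \<in> C \<inter> ball p (e / 2)"
    have eq: "u + (1/2) *\<^sub>R (q' - p) - midpoint p q = (u - p) + (1/2) *\<^sub>R (q' - q)"
      by (simp add: midpoint_def vec_eq_iff field_simps)
    have "norm ((u - p) + (1/2) *\<^sub>R (q' - q)) \<le> norm (u - p) + norm (q' - q) / 2"
      using norm_triangle_ineq[of "u - p" "(1/2) *\<^sub>R (q' - q)"] by simp
    moreover have "norm (u - p) < e / 2" "norm (q' - q) < e / 2"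
      using u q' by (simp_all add: dist_norm norm_minus_commute)
    ultimately have "norm (u + (1/2) *\<^sub>R (q' - p) - midpoint p q) < e" unfolding eq using e(1) by linarith
    then have "u + (1/2) *\<^sub>R (q' - p) \<in> ball (midpoint p q) e"
      by (metis dist_commute dist_norm mem_ball)
    then show "\<exists>s>0. u + s *\<^sub>R (q' - p) \<in> C" using e(2) by (intro exI[of _ "1/2"]) auto
  qed
  then show ?thesis using e(1) by (intro exI[of _ "e / 2"]) simp
next
  case False
  obtain a where a: "a \<noteq> 0" "a \<bullet> p = a \<bullet> q" "\<And>x. x \<in> C \<Longrightarrow> a \<bullet> x \<le> a \<bullet> p" "a \<bullet> (p - c) \<ge> \<rho> * norm a"
    using supporting_line_through_chord[OF C pq(1,2) False] by blast
  define f where "f = q - p"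
  have f: "f \<noteq> 0" "a \<bullet> f = 0" using pq(3) a(2) by (auto simp: f_def inner_diff_right)
  define H where "H = a \<bullet> (p - c)"
  have H: "H > 0" "norm a / H \<le> 1 / \<rho>"
  proof -
    have "\<rho> * norm a > 0" using C(3) a(1) by simp
    then show "H > 0" using a(4) unfolding H_def by linarith
    then show "norm a / H \<le> 1 / \<rho>" using a(4) C(3) unfolding H_def by (simp add: divide_simps mult.commute)
  qed
  \<comment> \<open>Displacing an end by at most \<open>e\<close> and correcting by at most the
    fraction \<open>e / \<rho>\<close> of its way to \<open>c\<close> changes the chord by at most
    \<open>e * D\<close>. Below the length of \<open>f\<close>, this leaves a parallel vector a
    positive multiple of \<open>f\<close>.\<close>
  define D where "D = 1 + (norm (c - p) + norm (c - q)) / \<rho>"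
  have D: "D \<ge> 1" using C(3) by (simp add: D_def)
  define e where "e = min \<rho> (norm f / (2 * D))"
  have e: "e > 0" "e \<le> \<rho>" "e * D < norm f"
  proof -
    show "e > 0" "e \<le> \<rho>" using C(3) f D by (auto simp: e_def)
    have "e * D \<le> norm f / (2 * D) * D" using D by (intro mult_right_mono) (auto simp: e_def)
    also have "\<dots> < norm f" using D f by simp
    finally show "e * D < norm f" .
  qed
  have De: "e + e / \<rho> * norm (c - p) < norm f" "e + e / \<rho> * norm (c - q) < norm f"
  proof -
    have "e * D = e + e / \<rho> * norm (c - p) + e / \<rho> * norm (c - q)" by (simp add: D_def algebra_simps add_divide_distrib)
    moreover have "e / \<rho> * norm (c - p) \<ge> 0" "e / \<rho> * norm (c - q) \<ge> 0" using e(1) C(3) by simp_all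
    ultimately show "e + e / \<rho> * norm (c - p) < norm f" "e + e / \<rho> * norm (c - q) < norm f" using e(3) by linarith+
  qed
  have height: "a \<bullet> z / H \<le> e / \<rho>" if "norm z < e" for z
  proof -
    have "a \<bullet> z \<le> norm a * norm z" by (rule norm_cauchy_schwarz)
    also have "\<dots> \<le> norm a * e" using that by (intro mult_left_mono) auto
    finally have "a \<bullet> z / H \<le> norm a / H * e" using H(1) by (simp add: divide_simps)
    also have "\<dots> \<le> 1 / \<rho> * e" using H(2) e(1) by (intro mult_right_mono) auto
    finally show ?thesis by simp
  qed
  have fK: "f \<in> feasible C p e"
    unfolding feasible_def
  proof (intro CollectI ballI)
    fix u assume u: "u \<in> C \<inter> ball p e"
    define t where "t = a \<bullet> (p - u) / H"
    have t0: "t \<ge> 0" using a(3)[of u] u H(1) by (simp add: t_def inner_diff_right)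
    have te: "t \<le> e / \<rho>" unfolding t_def by (rule height) (use u in \<open>simp add: dist_norm\<close>)
    also have "e / \<rho> \<le> 1" using e(2) C(3) by simp
    finally have t1: "t \<le> 1" .
    \<comment> \<open>The point between \<open>q\<close> and \<open>c\<close> at the same depth as
      \<open>u\<close>, so that \<open>z - u\<close> is parallel to the chord.\<close>
    define z where "z = (1 - t) *\<^sub>R q + t *\<^sub>R c"
    have "c \<in> C" using C(2,3) by auto
    then have zC: "z \<in> C" unfolding z_def using C(1) pq(2) t0 t1 by (intro convexD) auto
    have "a \<bullet> (z - u) = a \<bullet> (p - u) - t * H"
      using a(2) by (simp add: z_def H_def algebra_simps inner_add_right inner_diff_right)
    then have "a \<bullet> (z - u) = 0" using H(1) by (simp add: t_def)
    moreover have "norm (z - u - f) < norm f"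
    proof -
      have eq: "z - u - f = (p - u) + t *\<^sub>R (c - q)" by (simp add: z_def f_def algebra_simps)
      have "norm (z - u - f) \<le> norm (p - u) + t * norm (c - q)"
        unfolding eq using norm_triangle_ineq[of "p - u" "t *\<^sub>R (c - q)"] t0 by simp
      also have "\<dots> \<le> e + e / \<rho> * norm (c - q)"
        using u te by (intro add_mono mult_right_mono) (auto simp: dist_norm)
      finally show ?thesis using De(2) by linarith
    qed
    ultimately obtain k where "k > 0" "z - u = k *\<^sub>R f" using positive_multiple[OF a(1) f] by blast
    then show "\<exists>s>0. u + s *\<^sub>R f \<in> C" using zC by (metis add.commute diff_add_cancel)
  qed
  have cK: "c - p \<in> feasible C p e" by (rule inball_feasible[OF C(2)]) (use e(2) in simp)
  have "q' - p \<in> feasible C p e" if q': "q' \<in> C \<inter> ball q e" for q'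
  proof -
    \<comment> \<open>The relative depth of \<open>q'\<close>; without its component along
      \<open>c - p\<close>, the vector \<open>q' - p\<close> is parallel to the chord.\<close>
    define b where "b = a \<bullet> (q - q') / H"
    have b0: "b \<ge> 0" using a(2) a(3)[of q'] q' H(1) by (simp add: b_def inner_diff_right)
    have be: "b \<le> e / \<rho>" unfolding b_def by (rule height) (use q' in \<open>simp add: dist_norm\<close>)
    define z where "z = q' - p - b *\<^sub>R (c - p)"
    have "a \<bullet> z = a \<bullet> (q' - q) + b * H"
      using a(2) by (simp add: z_def H_def algebra_simps inner_add_right inner_diff_right)
    then have "a \<bullet> z = 0" using H(1) by (simp add: b_def inner_diff_right)
    moreover have "norm (z - f) < norm f"
    proof -
      have eq: "z - f = (q' - q) - b *\<^sub>R (c - p)" by (simp add: z_def f_def algebra_simps)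
      have "norm (z - f) \<le> norm (q' - q) + b * norm (c - p)"
        unfolding eq using norm_triangle_ineq4[of "q' - q" "b *\<^sub>R (c - p)"] b0 by simp
      also have "\<dots> \<le> e + e / \<rho> * norm (c - p)"
        using q' be by (intro add_mono mult_right_mono) (auto simp: dist_norm norm_minus_commute)
      finally show ?thesis using De(1) by linarith
    qed
    ultimately obtain k where k: "k > 0" "z = k *\<^sub>R f" using positive_multiple[OF a(1) f] by blast
    have "k *\<^sub>R f + b *\<^sub>R (c - p) \<in> feasible C p e"
      using k(1) b0 fK cK C(1) by (intro add_feasible scaleR_feasible) auto
    moreover have "q' - p = k *\<^sub>R f + b *\<^sub>R (c - p)" using k(2) by (simp add: z_def algebra_simps)
    ultimately show ?thesis by simp
  qed
  then show ?thesis using e(1) by blast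
qed

text \<open>One radius serves all distant ends \<open>q\<close>, by compactness of \<open>C\<close>
  without the open ball of radius \<open>l\<close> around \<open>p\<close>.\<close>

lemma feasible_chords:
  fixes C :: "(real^2) set"
  assumes C: "convex C" "compact C" "cball c \<rho> \<subseteq> C" "\<rho> > 0" and p: "p \<in> C" and l: "l > 0" "\<delta> > 0"
  shows "\<exists>r>0. r \<le> \<delta> \<and> (\<forall>q\<in>C. dist p q \<ge> l \<longrightarrow> q - p \<in> feasible C p r)"
proof -
  let ?S = "C - ball p l"
  have "compact ?S" using C(2) by (intro compact_diff) auto
  have "\<exists>e>0. \<forall>q'\<in>C \<inter> ball q e. q' - p \<in> feasible C p e" if "q \<in> ?S" for q
    by (rule feasible_chord_local[OF C(1,3,4) p]) (use that l in auto)
  then obtain e where e: "\<And>q. q \<in> ?S \<Longrightarrow> e q > 0" "\<And>q q'. q \<in> ?S \<Longrightarrow> q' \<in> C \<inter> ball q (e q) \<Longrightarrow> q' - p \<in> feasible C p (e q)"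
    by metis
  have "?S \<subseteq> (\<Union>q\<in>?S. ball q (e q))" using e(1) by force
  then obtain F where F: "F \<subseteq> ?S" "finite F" "?S \<subseteq> (\<Union>q\<in>F. ball q (e q))"
    using compactE_image[OF \<open>compact ?S\<close>, of ?S "\<lambda>q. ball q (e q)"] by (metis open_ball)
  define r where "r = Min (insert \<delta> (e ` F))"
  have fin: "finite (insert \<delta> (e ` F))" using F(2) by simp
  have r: "r > 0" "r \<le> \<delta>" "\<And>q. q \<in> F \<Longrightarrow> r \<le> e q"
    using F(1) e(1) l fin by (auto simp: r_def)
  have "q - p \<in> feasible C p r" if q: "q \<in> C" "dist p q \<ge> l" for q
  proof -
    have "q \<in> ?S" using q by auto
    then obtain q0 where q0: "q0 \<in> F" "q \<in> ball q0 (e q0)" using F(3) by blast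
    then have "q - p \<in> feasible C p (e q0)" using e(2) F(1) q(1) by blast
    then show ?thesis using feasible_antimono[OF r(3)[OF q0(1)]] by blast
  qed
  then show ?thesis using r by blast
qed

section \<open>Local families at boundary points\<close>

definition rot :: "real^2 \<Rightarrow> real^2" where
  "rot x = (\<chi> i. if i = 1 then - x $ 2 else x $ 1)"

lemma rot_nth: "rot x $ 1 = - x $ 2" "rot x $ 2 = x $ 1"
  by (simp_all add: rot_def)

lemma cross2_eq_inner: "cross2 x y = rot x \<bullet> y"
  by (simp add: cross2_def inner_vec2 rot_nth)

lemma norm_rot: "norm (rot x) = norm x"
  by (simp add: norm_eq_sqrt_inner inner_vec2 rot_nth add.commute)

lemma cross2_rot: "cross2 (rot x) x = - (norm x)\<^sup>2"
  by (simp add: cross2_def rot_nth power2_norm_eq_inner inner_vec2)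

lemma abs_cross2_le: "\<bar>cross2 x y\<bar> \<le> norm x * norm y"
  unfolding cross2_eq_inner using Cauchy_Schwarz_ineq2[of "rot x" y] by (simp add: norm_rot)

lemma exists_perpendicular:
  assumes "e \<noteq> 0" "\<delta> \<ge> 0"
  shows "\<exists>u. norm u = \<delta> \<and> cross2 u e = - \<delta> * norm e"
  using assms
  by (intro exI[of _ "(\<delta> / norm e) *\<^sub>R rot e"]) (simp add: norm_rot cross2_simps cross2_rot power2_eq_square)

text \<open>The situation is viewed from \<open>C\<close>: moving by \<open>- v\<close> puts
  \<open>C\<close> back in place and the whole cell into the ball.\<close>

definition local_translates :: "(real^2) set \<Rightarrow> real^2 \<Rightarrow> real \<Rightarrow> (real^2) set \<Rightarrow> (real^2) set set" where
  "local_translates C p r Q = {(\<lambda>x. x + v) ` C |v. \<forall>z\<in>Q. z - v \<in> ball p r}"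

lemma mem_translate: "z \<in> (\<lambda>x. x + v) ` C \<longleftrightarrow> z - v \<in> (C :: 'a::ab_group_add set)"
  by (auto simp: image_iff algebra_simps) (metis diff_add_cancel)

text \<open>The index \<open>j\<close> stands for a small ball around a boundary point \<open>p j\<close>, and \<open>Q\<close> for a cell.\<close>

locale germs =
  fixes C :: "(real^2) set" and c :: "real^2" and \<rho> D l :: real
    and J :: "'i set" and p :: "'i \<Rightarrow> real^2" and r :: "'i \<Rightarrow> real" and Q :: "(real^2) set"
  assumes convex: "convex C" and closed: "closed C" and inball: "cball c \<rho> \<subseteq> C" and \<rho>: "\<rho> > 0"
    and l: "l > 0" "l \<le> \<rho> / 4" "D * l < \<rho>\<^sup>2 / 4"
    and p: "\<And>j. j \<in> J \<Longrightarrow> p j \<in> C" "\<And>j. j \<in> J \<Longrightarrow> \<rho> \<le> dist c (p j)" "\<And>j. j \<in> J \<Longrightarrow> dist c (p j) \<le> D"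
    and r: "\<And>j. j \<in> J \<Longrightarrow> 0 < r j" "\<And>j. j \<in> J \<Longrightarrow> r j \<le> \<rho> / 4"
    and far: "\<And>j q. j \<in> J \<Longrightarrow> q \<in> C \<Longrightarrow> l \<le> dist (p j) q \<Longrightarrow> q - p j \<in> feasible C (p j) (r j)"
begin

abbreviation K :: "'i \<Rightarrow> (real^2) set" where "K j \<equiv> feasible C (p j) (r j)"

abbreviation F :: "'i \<Rightarrow> (real^2) set set" where "F j \<equiv> local_translates C (p j) (r j) Q"

lemma near: "j \<in> J \<Longrightarrow> dist (p j) q + dist c c' \<le> 3 * \<rho> / 4 \<Longrightarrow> c' - q \<in> K j"
  using inball_feasible[OF inball, of "p j" q "r j" c'] r(2)[of j] by simp

lemma near_shift: "j \<in> J \<Longrightarrow> u \<in> ball (p j) (r j) \<Longrightarrow> dist (p j) q \<le> 3 * \<rho> / 4 \<Longrightarrow> u + (c - q) \<in> C"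
  using inball_shift[OF inball, of u "p j" "r j" q c] r(2)[of j] by simp

lemma below_F:
  assumes "j \<in> J" "x \<in> Q" "y \<in> Q" "y - x \<in> K j"
  shows "below (F j) x y"
  unfolding below_def
proof (intro ballI impI)
  fix X assume "X \<in> F j" "x \<in> X"
  then obtain v where v: "X = (\<lambda>x. x + v) ` C" "\<forall>z\<in>Q. z - v \<in> ball (p j) (r j)"
    unfolding local_translates_def by blast
  then have "x - v \<in> C" using \<open>x \<in> X\<close> by (simp add: mem_translate)
  moreover have eq: "(x - v) + (y - x) = y - v" by simp
  ultimately have "y - v \<in> C"
    using feasible_stays[OF convex closed p(1)[OF assms(1)] assms(4), of "x - v"] v(2) assms(3) by simp
  then show "y \<in> X" using v(1) by (simp add: mem_translate)
qed

text \<open>The common cone contains \<open>c - q\<close> and, by the room in the inball,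
  \<open>c + u - q\<close>. With \<open>u\<close> orthogonal to \<open>g\<close>, these cannot both
  be parallel to \<open>g\<close>.\<close>

lemma cross2_full:
  assumes "S \<subseteq> J" "\<And>j. j \<in> S \<Longrightarrow> dist (p j) q \<le> \<rho> / 4" "g \<noteq> 0"
  shows "\<exists>w\<in>\<Inter>j\<in>S. K j. cross2 g w \<noteq> 0"
proof -
  obtain u where u: "norm u = \<rho> / 2" "cross2 u g = - (\<rho> / 2) * norm g"
    using exists_perpendicular[OF assms(3), of "\<rho> / 2"] \<rho> by auto
  have mem: "(c + u) - q \<in> K j" "c - q \<in> K j" if "j \<in> S" for j
    using near[of j q "c + u"] near[of j q c] assms(1) assms(2)[OF that] that u(1) \<rho> by (auto simp: dist_norm)
  have "cross2 g ((c + u) - q) - cross2 g (c - q) = - cross2 u g"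
    by (simp add: cross2_simps cross2_commute[of u])
  moreover have "(\<rho> / 2) * norm g > 0" using \<rho> assms(3) by simp
  ultimately have "cross2 g ((c + u) - q) \<noteq> cross2 g (c - q)" using u(2) by linarith
  then show ?thesis using mem by (cases "cross2 g (c - q) = 0") auto
qed

lemma one_side_Inter:
  assumes "S \<subseteq> J" "S \<noteq> {}" "\<And>j. j \<in> S \<Longrightarrow> dist (p j) q \<le> \<rho> / 4"
    and "d \<notin> (\<Inter>j\<in>S. K j)" "- d \<notin> (\<Inter>j\<in>S. K j)"
    and "g \<in> (\<Inter>j\<in>S. K j)" "g \<noteq> 0" "h \<in> (\<Inter>j\<in>S. K j)" "h \<noteq> 0"
  shows "cross2 d g * cross2 d h > 0"
proof (rule cone_one_side[of "\<Inter>j\<in>S. K j"])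
  show "x + y \<in> (\<Inter>j\<in>S. K j)" if "x \<in> (\<Inter>j\<in>S. K j)" "y \<in> (\<Inter>j\<in>S. K j)" for x y
    using that add_feasible[OF convex] by blast
  show "k *\<^sub>R x \<in> (\<Inter>j\<in>S. K j)" if "0 \<le> k" "x \<in> (\<Inter>j\<in>S. K j)" for k x
    using that scaleR_feasible by blast
  show "\<exists>w\<in>\<Inter>j\<in>S. K j. cross2 g w \<noteq> 0" if "g \<noteq> 0" for g
    using cross2_full[OF assms(1,3) that] .
qed (use assms in auto)

lemma one_side:
  assumes "j \<in> J" "d \<notin> K j" "- d \<notin> K j" "g \<in> K j" "g \<noteq> 0" "h \<in> K j" "h \<noteq> 0"
  shows "cross2 d g * cross2 d h > 0"
  using one_side_Inter[of "{j}" "p j" d g h] assms \<rho> by simp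

lemma cross2_multiple:
  assumes "j \<in> J" "g \<in> K j" "h \<in> K j" "cross2 d g \<ge> 0" "cross2 d h \<le> 0"
  shows "cross2 h g > 0 \<Longrightarrow> d \<in> K j" "cross2 h g < 0 \<Longrightarrow> - d \<in> K j"
proof -
  have "cross2 d g *\<^sub>R h + (- cross2 d h) *\<^sub>R g \<in> K j"
    using assms by (intro add_feasible[OF convex] scaleR_feasible) auto
  then have m: "cross2 h g *\<^sub>R d \<in> K j" using cross2_eliminate[of d g h] by simp
  show "d \<in> K j" if "cross2 h g > 0"
    using scaleR_feasible[OF m, of "1 / cross2 h g"] that by simp
  show "- d \<in> K j" if "cross2 h g < 0"
    using scaleR_feasible[OF m, of "- (1 / cross2 h g)"] that by simp
qed

text \<open>If \<open>w\<close> were on the wrong side of \<open>d\<close>, the cones at \<open>p j\<close> and \<open>p k\<close> would contain \<open>d\<close> resp. \<open>- d\<close> unless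
  the inball saw the chords from \<open>p i\<close> to \<open>p j\<close> and to \<open>p k\<close> from different sides, which is impossible as
  \<open>p j\<close> and \<open>p k\<close> are close.\<close>

lemma far_pair_orientation:
  assumes J: "i \<in> J" "j \<in> J" "k \<in> J" and jk: "dist (p j) (p k) < l"
    and i: "\<rho> / 2 \<le> dist (p j) (p i)" "\<rho> / 2 \<le> dist (p k) (p i)"
    and d: "cross2 d (p j - p i) < 0" "cross2 d (p k - p i) < 0" "d \<notin> K j" "- d \<notin> K k"
    and w: "w \<in> K j" "w \<in> K k" "w \<noteq> 0"
  shows "cross2 d w > 0"
proof (rule ccontr)
  assume neg: "\<not> cross2 d w > 0"
  have jk': "dist (p k) (p j) < l" using jk by (simp add: dist_commute)
  have cK: "c' - p j \<in> K j" "c' - p j \<in> K k" if "dist c c' \<le> \<rho> / 2" for c'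
    using near[OF J(2), of "p j" c'] near[OF J(3), of "p j" c'] that jk' l by auto
  have cneg: "cross2 d (c' - p j) < 0" if c': "dist c c' \<le> \<rho> / 2" for c'
  proof -
    have "dist c (p j) \<le> dist c c' + dist c' (p j)" by (rule dist_triangle)
    then have "c' - p j \<noteq> 0" using p(2)[OF J(2)] c' \<rho> by auto
    moreover have "dist (p ja) (p j) \<le> \<rho> / 4" if "ja \<in> {j, k}" for ja using that jk' l \<rho> by auto
    \<comment> \<open>The intersection of the two cones is used because \<open>d\<close> is excluded
      from one of them and \<open>- d\<close> from the other.\<close>
    ultimately have "cross2 d w * cross2 d (c' - p j) > 0"
      using one_side_Inter[of "{j, k}" "p j" d w "c' - p j"] J d w cK[OF c'] by auto
    then show ?thesis using neg by (auto simp: zero_less_mult_iff)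
  qed
  have chord: "p i - p j \<in> K j" "p i - p k \<in> K k"
    using far[OF J(2) p(1)[OF J(1)]] far[OF J(3) p(1)[OF J(1)]] i l by auto
  have chord_pos: "cross2 d (p i - p j) \<ge> 0" "cross2 d (p i - p k) \<ge> 0"
    using d(1,2) by (simp_all add: cross2_simps)
  have sj: "cross2 (c' - p j) (p j - p i) \<ge> 0" if c': "dist c c' \<le> \<rho> / 2" for c'
    using cross2_multiple(1)[OF J(2) chord(1) cK(1)[OF c'] chord_pos(1) less_imp_le[OF cneg[OF c']]] d(3)
    by (force simp: cross2_simps)
  have sk: "cross2 (c' - p j) (p k - p i) \<le> 0" if c': "dist c c' \<le> \<rho> / 2" for c'
    using cross2_multiple(2)[OF J(3) chord(2) cK(2)[OF c'] chord_pos(2) less_imp_le[OF cneg[OF c']]] d(4)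
    by (force simp: cross2_simps)
  have ne: "p j - p i \<noteq> 0" using i(1) \<rho> by auto
  \<comment> \<open>Displacing \<open>c\<close> by \<open>u\<close> sharpens \<open>sj\<close> at
    \<open>c\<close> by the margin \<open>\<rho>\<^sup>2 / 4\<close>. Compared with
    \<open>sk\<close> at \<open>c\<close>, this exceeds \<open>D * l\<close>, which bounds the
    effect of replacing \<open>p j\<close> by \<open>p k\<close>.\<close>
  obtain u where u: "norm u = \<rho> / 2" "cross2 u (p j - p i) = - (\<rho> / 2) * norm (p j - p i)"
    using exists_perpendicular[OF ne, of "\<rho> / 2"] \<rho> by auto
  have "cross2 ((c + u) - p j) (p j - p i) \<ge> 0" using sj[of "c + u"] u(1) by (simp add: dist_norm)
  moreover have "(c + u) - p j = (c - p j) + u" by simp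
  ultimately have "cross2 (c - p j) (p j - p i) + cross2 u (p j - p i) \<ge> 0" by (metis cross2_simps(2))
  then have "cross2 (c - p j) (p j - p i) \<ge> (\<rho> / 2) * norm (p j - p i)" using u(2) by simp
  also have "(\<rho> / 2) * norm (p j - p i) \<ge> (\<rho> / 2) * (\<rho> / 2)"
    using i(1) \<rho> by (intro mult_left_mono) (auto simp: dist_norm)
  finally have "cross2 (c - p j) (p j - p i) \<ge> \<rho>\<^sup>2 / 4" by (simp add: power2_eq_square)
  moreover have "cross2 (c - p j) (p k - p i) \<le> 0" using sk[of c] \<rho> by simp
  moreover have "cross2 (c - p j) (p j - p i) - cross2 (c - p j) (p k - p i) = cross2 (c - p j) (p j - p k)"
    by (simp add: cross2_simps)
  ultimately have "\<rho>\<^sup>2 / 4 \<le> cross2 (c - p j) (p j - p k)" by linarith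
  also have "\<dots> \<le> norm (c - p j) * norm (p j - p k)" using abs_cross2_le[of "c - p j" "p j - p k"] by linarith
  also have "\<dots> \<le> D * l"
    using p(3)[OF J(2)] jk by (intro mult_mono) (auto simp: dist_norm intro: order_trans[OF norm_ge_zero])
  finally show False using l(3) by simp
qed

lemma F_translate:
  assumes "X \<in> F j"
  obtains v where "\<And>z. z \<in> X \<longleftrightarrow> z - v \<in> C" "\<And>z. z \<in> Q \<Longrightarrow> z - v \<in> ball (p j) (r j)"
  using assms unfolding local_translates_def by (auto simp: mem_translate)

text \<open>For the direction \<open>c - q\<close>, \<open>near_shift\<close> supplies the inner
  points required by \<open>translates_cross_once\<close>. The factor
  \<open>cross2 (c - q) (v - v')\<close> is the same for \<open>a\<close> and \<open>e\<close>, so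
  \<open>b\<close> cannot lie between them.\<close>

lemma cross_once:
  assumes J: "j \<in> J" "k \<in> J" and q: "dist (p j) q \<le> 3 * \<rho> / 4" "dist (p k) q \<le> 3 * \<rho> / 4" "c \<noteq> q"
    and X: "X \<in> F j" and Y: "Y \<in> F k" and abe: "a \<in> Q" "b \<in> Q" "e \<in> Q"
    and mem: "a \<in> X" "a \<notin> Y" "e \<in> X" "e \<notin> Y" "b \<in> Y" "b \<notin> X"
  shows "cross2 (c - q) (b - a) * cross2 (c - q) (b - e) > 0"
proof -
  obtain v where v: "\<And>z. z \<in> X \<longleftrightarrow> z - v \<in> C" "\<And>z. z \<in> Q \<Longrightarrow> z - v \<in> ball (p j) (r j)"
    using F_translate[OF X] by blast
  obtain v' where v': "\<And>z. z \<in> Y \<longleftrightarrow> z - v' \<in> C" "\<And>z. z \<in> Q \<Longrightarrow> z - v' \<in> ball (p k) (r k)"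
    using F_translate[OF Y] by blast
  have nz: "c - q \<noteq> 0" using q(3) by simp
  have once: "cross2 (c - q) (b - x) * cross2 (c - q) (v - v') < 0" if "x \<in> Q" "x \<in> X" "x \<notin> Y" for x
    by (rule translates_cross_once[OF convex nz])
      (use that v v' mem(5,6) abe(2) near_shift[OF J(1) _ q(1)] near_shift[OF J(2) _ q(2)] in auto)
  from once[of a] once[of e] show ?thesis using abe mem by (auto simp: mult_less_0_iff zero_less_mult_iff)
qed

text \<open>The order comes from \<open>c - p i\<close>, a vector of \<open>K i\<close>. For near
  families \<open>cross_once\<close> is applied with \<open>q = p i\<close> and excludes the pattern
  directly. For far ones it is applied with \<open>q = p j\<close>, and
  \<open>far_pair_orientation\<close> shows that the three points in question appear in reversed
  order along that direction.\<close>

lemma two_sided_antichain: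
  assumes i: "i \<in> J" and RQ: "R \<subseteq> Q" and anti: "\<forall>x\<in>R. \<forall>y\<in>R. x \<noteq> y \<longrightarrow> \<not> below (F i) x y"
  shows "two_sided F J i R"
  unfolding two_sided_def
proof (intro allI impI)
  fix U assume UJ: "U \<subseteq> J"
    and U: "\<forall>j\<in>U. \<forall>k\<in>U. \<exists>x\<in>R. \<exists>y\<in>R. x \<noteq> y \<and> incomparable (F j) x y \<and> incomparable (F k) x y"
  define f where "f z = cross2 (c - p i) z" for z
  define T where "T = {j\<in>U. dist (p j) (p i) < \<rho> / 2}"
  define B where "B = {j\<in>U. dist (p j) (p i) \<ge> \<rho> / 2}"
  have wK: "c - p i \<in> K i" using near[OF i, of "p i" c] \<rho> by simp
  have w0: "c - p i \<noteq> 0" using p(2)[OF i] \<rho> by auto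
  have nK: "y - x \<notin> K i" "- (y - x) \<notin> K i" if "x \<in> R" "y \<in> R" "x \<noteq> y" for x y
    using below_F[OF i, of x y] below_F[OF i, of y x] anti that RQ by auto
  have inc: "y - x \<notin> K j" "- (y - x) \<notin> K j" if "incomparable (F j) x y" "j \<in> J" "x \<in> R" "y \<in> R" for x y j
    using below_F[of j x y] below_F[of j y x] that RQ unfolding incomparable_def by auto
  have inj: "inj_on f R"
  proof (rule inj_onI, rule ccontr)
    fix x y assume xy: "x \<in> R" "y \<in> R" "f x = f y" "x \<noteq> y"
    have "cross2 (y - x) (c - p i) * cross2 (y - x) (c - p i) > 0"
      by (rule one_side[OF i nK[OF xy(1,2,4)] wK w0 wK w0])
    moreover have "cross2 (c - p i) (y - x) = 0" using xy(3) by (simp add: f_def cross2_simps(3))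
    ultimately show False using cross2_commute[of "y - x" "c - p i"] by simp
  qed
  have BJ: "j \<in> J" "j \<in> U" "\<rho> / 2 \<le> dist (p j) (p i)" "p j - p i \<noteq> 0" if "j \<in> B" for j
    using that UJ \<rho> by (auto simp: B_def)
  have eK: "p j - p i \<in> K i" "p i - p j \<in> K j" if "j \<in> B" for j
    using far[OF i p(1)[OF BJ(1)[OF that]]] far[OF BJ(1)[OF that] p(1)[OF i]] BJ(3)[OF that] l by (auto simp: dist_commute)
  \<comment> \<open>For a common incomparable difference \<open>?d\<close>, \<open>one_side\<close>
    makes each of \<open>p i\<close>, \<open>p j\<close>, \<open>p k\<close> a strict extreme of the
    three for the functional \<open>cross2 ?d\<close>; but one of three values is always in the
    middle.\<close>
  have Bclose: "dist (p j) (p k) < l" if jk: "j \<in> B" "k \<in> B" for j k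
  proof (rule ccontr)
    assume "\<not> dist (p j) (p k) < l"
    then have jkl: "l \<le> dist (p j) (p k)" "l \<le> dist (p k) (p j)" by (simp_all add: dist_commute)
    then have E: "p k - p j \<in> K j" "p j - p k \<in> K k" "p k - p j \<noteq> 0"
      using far[OF BJ(1)[OF jk(1)] p(1)[OF BJ(1)[OF jk(2)]]] far[OF BJ(1)[OF jk(2)] p(1)[OF BJ(1)[OF jk(1)]]] l by auto
    obtain x y where xy: "x \<in> R" "y \<in> R" "x \<noteq> y" "incomparable (F j) x y" "incomparable (F k) x y"
      using U BJ(2) jk by blast
    let ?d = "y - x"
    have 1: "cross2 ?d (p j - p i) * cross2 ?d (p k - p i) > 0"
      by (rule one_side[OF i nK[OF xy(1-3)]]) (use eK jk BJ(4) in auto)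
    have 2: "cross2 ?d (p i - p j) * cross2 ?d (p k - p j) > 0"
      by (rule one_side[OF BJ(1)[OF jk(1)] inc[OF xy(4) BJ(1)[OF jk(1)] xy(1,2)]])
        (use eK(2)[OF jk(1)] BJ(4)[OF jk(1)] E in auto)
    have 3: "cross2 ?d (p i - p k) * cross2 ?d (p j - p k) > 0"
      by (rule one_side[OF BJ(1)[OF jk(2)] inc[OF xy(5) BJ(1)[OF jk(2)] xy(1,2)]])
        (use eK(2)[OF jk(2)] BJ(4)[OF jk(2)] E in auto)
    show False using 1 2 3 unfolding cross2_simps zero_less_mult_iff by linarith
  qed
  have sideB: "cross2 (y - x) (p j - p i) < 0" if "x \<in> R" "y \<in> R" "f x < f y" "j \<in> B" for x y j
  proof -
    have "x \<noteq> y" using that by auto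
    then have "cross2 (y - x) (c - p i) * cross2 (y - x) (p j - p i) > 0"
      using one_side[OF i nK[OF that(1,2)] wK w0 eK(1)[OF that(4)] BJ(4)[OF that(4)]] by simp
    moreover have "cross2 (y - x) (c - p i) < 0"
      using that(3) cross2_commute[of "y - x" "c - p i"] by (simp add: f_def cross2_simps(3))
    ultimately show ?thesis by (simp add: zero_less_mult_iff)
  qed
  have abaT: "ABA_free f R (\<Union>j\<in>T. F j)"
    unfolding ABA_free_def
  proof (intro ballI impI, rule ccontr)
    fix X Y a b e
    assume XY: "X \<in> (\<Union>j\<in>T. F j)" "Y \<in> (\<Union>j\<in>T. F j)" and abe: "a \<in> R" "b \<in> R" "e \<in> R" "f a < f b" "f b < f e"
      and mem: "a \<in> X" "e \<in> X" "b \<in> Y" "\<not> (a \<in> Y \<or> e \<in> Y \<or> b \<in> X)"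
    obtain j k where jk: "j \<in> T" "X \<in> F j" "k \<in> T" "Y \<in> F k" using XY by blast
    have "cross2 (c - p i) (b - a) * cross2 (c - p i) (b - e) > 0"
      by (rule cross_once[OF _ _ _ _ _ jk(2,4)]) (use jk UJ \<rho> w0 abe mem RQ in \<open>auto simp: T_def\<close>)
    then show False using abe(4,5) by (simp add: f_def cross2_simps zero_less_mult_iff)
  qed
  have abaB: "ABA_free f R (\<Union>j\<in>B. F j)"
    unfolding ABA_free_def
  proof (intro ballI impI, rule ccontr)
    fix X Y a b e
    assume XY: "X \<in> (\<Union>j\<in>B. F j)" "Y \<in> (\<Union>j\<in>B. F j)" and abe: "a \<in> R" "b \<in> R" "e \<in> R" "f a < f b" "f b < f e"
      and mem: "a \<in> X" "e \<in> X" "b \<in> Y" "\<not> (a \<in> Y \<or> e \<in> Y \<or> b \<in> X)"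
    obtain j k where jk: "j \<in> B" "X \<in> F j" "k \<in> B" "Y \<in> F k" using XY by blast
    note J = BJ(1)[OF jk(1)] BJ(1)[OF jk(3)]
    have cl: "dist (p j) (p k) < l" "dist (p k) (p j) < l" using Bclose jk by auto
    have \<nu>: "c - p j \<in> K j" "c - p j \<in> K k" "c - p j \<noteq> 0" "c \<noteq> p j"
      using near[OF J(1), of "p j" c] near[OF J(2), of "p j" c] p(2)[OF J(1)] cl l \<rho> by auto
    have abQ: "a \<in> Q" "b \<in> Q" "e \<in> Q" using abe RQ by auto
    \<comment> \<open>\<open>X\<close> contains \<open>a\<close> and \<open>e\<close> but not
      \<open>b\<close>, and \<open>Y\<close> the reverse. Hence each consecutive difference is
      excluded from one cone and its negative from the other, as \<open>far_pair_orientation\<close>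
      demands.\<close>
    have not: "b - a \<notin> K j" "- (b - a) \<notin> K k" "- (e - b) \<notin> K j" "e - b \<notin> K k"
      using below_F[OF J(1), of a b] below_F[OF J(2), of b a] below_F[OF J(1), of e b] below_F[OF J(2), of b e] abQ mem jk(2,4)
      unfolding below_def by auto
    have 1: "cross2 (b - a) (c - p j) > 0"
      by (rule far_pair_orientation[OF i J cl(1) BJ(3)[OF jk(1)] BJ(3)[OF jk(3)] _ _ not(1,2) \<nu>(1,2,3)])
        (use sideB abe jk in auto)
    have 2: "cross2 (e - b) (c - p j) > 0"
      by (rule far_pair_orientation[OF i J(2,1) cl(2) BJ(3)[OF jk(3)] BJ(3)[OF jk(1)] _ _ not(4,3) \<nu>(2,1,3)])
        (use sideB abe jk in auto)
    have "cross2 (c - p j) (b - a) * cross2 (c - p j) (b - e) > 0"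
      by (rule cross_once[OF J _ _ \<nu>(4) jk(2,4) abQ]) (use \<rho> cl l mem in auto)
    moreover have "cross2 (c - p j) (b - a) < 0" using 1 cross2_commute[of "b - a" "c - p j"] by simp
    moreover have "cross2 (c - p j) (b - e) > 0"
      using 2 cross2_commute[of "e - b" "c - p j"] cross2_simps(5)[of "c - p j" "e - b"] by simp
    ultimately show False by (simp add: zero_less_mult_iff)
  qed
  show "\<exists>f T B. U = T \<union> B \<and> (i \<in> U \<longrightarrow> i \<in> T) \<and> inj_on f R \<and>
       ABA_free f R (\<Union>j\<in>T. F j) \<and> ABA_free f R (\<Union>j\<in>B. F j)"
  proof (rule exI[of _ f], rule exI[of _ T], rule exI[of _ B], intro conjI)
    show "U = T \<union> B" unfolding T_def B_def by auto
    show "i \<in> U \<longrightarrow> i \<in> T" using \<rho> by (simp add: T_def)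
  qed (fact inj abaT abaB)+
qed

end

section \<open>Cutting the plane into cells\<close>

definition grid_index :: "real \<Rightarrow> real^2 \<Rightarrow> int \<times> int" where
  "grid_index h z = (\<lfloor>z $ 1 / h\<rfloor>, \<lfloor>z $ 2 / h\<rfloor>)"

definition grid_cell :: "real \<Rightarrow> int \<times> int \<Rightarrow> (real^2) set" where
  "grid_cell h k = {z. grid_index h z = k}"

lemma floor_div_eq_iff: "h > 0 \<Longrightarrow> \<lfloor>x / h\<rfloor> = i \<longleftrightarrow> of_int i * h \<le> x \<and> x < (of_int i + 1) * (h::real)"
  by (simp add: floor_eq_iff pos_le_divide_eq pos_divide_less_eq)

lemma mem_grid_cell:
  assumes "h > 0"
  shows "z \<in> grid_cell h k \<longleftrightarrow> of_int (fst k) * h \<le> z $ 1 \<and> z $ 1 < (of_int (fst k) + 1) * h \<and>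
    of_int (snd k) * h \<le> z $ 2 \<and> z $ 2 < (of_int (snd k) + 1) * h"
  unfolding grid_cell_def grid_index_def mem_Collect_eq prod_eq_iff fst_conv snd_conv floor_div_eq_iff[OF assms]
  by blast

lemma convex_grid_cell:
  assumes "h > 0"
  shows "convex (grid_cell h k)"
proof -
  have "grid_cell h k = ({z. axis 1 1 \<bullet> z \<ge> of_int (fst k) * h} \<inter> {z. axis 1 1 \<bullet> z < (of_int (fst k) + 1) * h}) \<inter>
      ({z. axis 2 1 \<bullet> z \<ge> of_int (snd k) * h} \<inter> {z. axis 2 1 \<bullet> z < (of_int (snd k) + 1) * h})"
    by (auto simp: mem_grid_cell[OF assms] inner_axis')
  then show ?thesis by (auto intro!: convex_Int convex_halfspace_ge convex_halfspace_lt)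
qed

lemma dist_grid_cell:
  assumes "h > 0" "x \<in> grid_cell h k" "y \<in> grid_cell h k"
  shows "dist x y < 2 * h"
proof -
  have "\<bar>(x - y) $ i\<bar> < h" for i
  proof -
    have "\<bar>(x - y) $ 1\<bar> < h" "\<bar>(x - y) $ 2\<bar> < h"
      using assms(2,3) unfolding mem_grid_cell[OF assms(1)] by (auto simp: algebra_simps)
    then show ?thesis using exhaust_2[of i] by auto
  qed
  from this[of 1] this[of 2] have "\<bar>(x - y) $ 1\<bar> + \<bar>(x - y) $ 2\<bar> < 2 * h" by linarith
  moreover have "norm (x - y) \<le> \<bar>(x - y) $ 1\<bar> + \<bar>(x - y) $ 2\<bar>"
    using norm_le_l1_cart[of "x - y"] by (simp add: sum_2)
  ultimately show ?thesis by (simp add: dist_norm)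
qed

definition grid_range :: "real \<Rightarrow> real \<Rightarrow> real \<Rightarrow> int set" where
  "grid_range h D t = {\<lfloor>(t - D) / h\<rfloor>..\<lfloor>(t + D) / h\<rfloor>}"

text \<open>The bound does not involve \<open>t\<close>, so the number of cells to consider is
  independent of the position of the translate.\<close>

lemma card_grid_range: "card (grid_range h D t) \<le> nat (\<lceil>2 * D / h\<rceil> + 1)"
proof -
  have "(t + D) / h - (t - D) / h = 2 * D / h" by (simp add: diff_divide_distrib[symmetric])
  then have "\<lfloor>(t + D) / h\<rfloor> - \<lfloor>(t - D) / h\<rfloor> \<le> \<lceil>2 * D / h\<rceil>" by linarith
  then show ?thesis unfolding grid_range_def by simp
qed

lemma grid_range_mem: "h > 0 \<Longrightarrow> \<bar>x - t\<bar> \<le> D \<Longrightarrow> \<lfloor>x / h\<rfloor> \<in> grid_range h D t"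
  unfolding grid_range_def by (auto intro!: floor_mono divide_right_mono)

text \<open>A translate that meets a convex set without containing it has a boundary point in it.\<close>

lemma local_translate_exists:
  fixes C :: "(real^2) set"
  assumes Q: "convex Q" "\<And>x y. x \<in> Q \<Longrightarrow> y \<in> Q \<Longrightarrow> dist x y < \<delta>"
    and meets: "Q \<inter> (\<lambda>x. x + v) ` C \<noteq> {}" "\<not> Q \<subseteq> (\<lambda>x. x + v) ` C"
    and cover: "frontier C \<subseteq> (\<Union>j\<in>J. ball (p j) (r j / 2))" "\<And>j. j \<in> J \<Longrightarrow> \<delta> \<le> r j / 2"
  shows "\<exists>j\<in>J. (\<lambda>x. x + v) ` C \<in> local_translates C (p j) (r j) Q"
proof -
  let ?S = "(\<lambda>x. - v + x) ` Q"
  have "connected ?S" using Q(1) by (intro convex_connected convex_translation)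
  moreover have "?S \<inter> C \<noteq> {}"
  proof -
    obtain z where "z \<in> Q" "z - v \<in> C" using meets(1) mem_translate[of _ v C] by blast
    then have "- v + z \<in> ?S \<inter> C" by simp
    then show ?thesis by blast
  qed
  moreover have "?S - C \<noteq> {}"
  proof -
    obtain z where "z \<in> Q" "z - v \<notin> C" using meets(2) mem_translate[of _ v C] by blast
    then have "- v + z \<in> ?S - C" by simp
    then show ?thesis by blast
  qed
  ultimately have "?S \<inter> frontier C \<noteq> {}" by (rule connected_Int_frontier)
  then obtain y where y: "y \<in> Q" "y - v \<in> frontier C" by auto
  then obtain j where j: "j \<in> J" "y - v \<in> ball (p j) (r j / 2)" using cover(1) by blast
  have "z - v \<in> ball (p j) (r j)" if "z \<in> Q" for z
  proof -
    have "dist (p j) (z - v) \<le> dist (p j) (y - v) + dist (y - v) (z - v)" by (rule dist_triangle)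
    also have "dist (y - v) (z - v) = dist y z" by (simp add: dist_norm)
    finally show ?thesis using j(2) Q(2)[OF y(1) that] cover(2)[OF j(1)] by simp
  qed
  then show ?thesis using j(1) unfolding local_translates_def by blast
qed

text \<open>A translate containing a whole cell need not belong to any local family, so
  \<open>V\<close> itself must show two colours. If the given colouring is constant on
  \<open>V\<close>, no member has more than \<open>M\<close> points there, and any recolouring is
  harmless.\<close>

lemma nonconstant_colouring:
  assumes c: "\<forall>x. c x < (3::nat)" "\<And>X. X \<in> \<F> \<Longrightarrow> card (X \<inter> V) > M \<Longrightarrow> bichromatic c (X \<inter> V)"
  shows "\<exists>c. (\<forall>x. c x < (3::nat)) \<and> (\<forall>X\<in>\<F>. card (X \<inter> V) > M \<longrightarrow> bichromatic c (X \<inter> V)) \<and>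
    (card V > 1 \<longrightarrow> bichromatic c V)"
proof (cases "bichromatic c V \<or> card V \<le> 1")
  case True then show ?thesis using c by (intro exI[of _ c]) auto
next
  case False
  then obtain a b where ab: "a \<in> V" "b \<in> V" "a \<noteq> b"
    by (metis card_le_Suc0_iff_eq card.infinite One_nat_def nat_le_linear not_one_le_zero)
  define e where "e x = (if x = a then 0 else (1::nat))" for x
  have "bichromatic e V" unfolding bichromatic_def using ab by (intro bexI[of _ a] bexI[of _ b]) (auto simp: e_def)
  moreover have "\<not> card (X \<inter> V) > M" if "X \<in> \<F>" for X
    using c(2)[OF that] bichromatic_mono[of c "X \<inter> V" V] False by blast
  ultimately show ?thesis by (intro exI[of _ e]) (simp add: e_def)
qed

text \<open>The boundary points themselves serve as indices. Compactness of the frontier leaves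
  finitely many balls, taken with half radius so that a cell meeting such a ball stays within the
  full one.\<close>

lemma body_local_structure:
  fixes C :: "(real^2) set"
  assumes "convex_body C"
  shows "\<exists>(J :: (real^2) set) r D. \<exists>h>0. finite J \<and>
    frontier C \<subseteq> (\<Union>j\<in>J. ball j (r j / 2)) \<and> (\<forall>j\<in>J. 2 * h \<le> r j / 2) \<and> (\<forall>x\<in>C. norm x \<le> D) \<and>
    (\<forall>Q. \<forall>i\<in>J. \<forall>R\<subseteq>Q. (\<forall>x\<in>R. \<forall>y\<in>R. x \<noteq> y \<longrightarrow> \<not> below (local_translates C i (r i) Q) x y) \<longrightarrow>
       two_sided (\<lambda>j. local_translates C j (r j) Q) J i R)"
proof -
  have C: "convex C" "compact C" "interior C \<noteq> {}" using assms unfolding convex_body_def by auto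
  then have closed: "closed C" by (simp add: compact_imp_closed)
  obtain c where "c \<in> interior C" using C(3) by blast
  then obtain \<rho> where \<rho>: "\<rho> > 0" "cball c \<rho> \<subseteq> C" unfolding mem_interior_cball by blast
  obtain D0 where D0: "\<And>x. x \<in> C \<Longrightarrow> norm x \<le> D0" using compact_imp_bounded[OF C(2)] by (auto simp: bounded_iff)
  define D where "D = max 1 (norm c + D0)"
  have D: "D > 0" "\<And>x. x \<in> C \<Longrightarrow> dist c x \<le> D"
  proof -
    show "D > 0" unfolding D_def by simp
    show "dist c x \<le> D" if "x \<in> C" for x
      using norm_triangle_ineq4[of c x] D0[OF that] unfolding D_def dist_norm by linarith
  qed
  \<comment> \<open>The second bound makes \<open>D * l\<close> at most
    \<open>\<rho>\<^sup>2 / 8\<close>, strictly below the margin in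
    \<open>far_pair_orientation\<close>.\<close>
  define l where "l = min (\<rho> / 4) (\<rho>\<^sup>2 / (8 * D))"
  have l: "l > 0" "l \<le> \<rho> / 4" "D * l < \<rho>\<^sup>2 / 4"
  proof -
    show "l > 0" "l \<le> \<rho> / 4" using \<rho>(1) D(1) by (auto simp: l_def)
    have "D * l \<le> D * (\<rho>\<^sup>2 / (8 * D))" using D(1) by (intro mult_left_mono) (auto simp: l_def)
    also have "\<dots> < \<rho>\<^sup>2 / 4" using D(1) \<rho>(1) by simp
    finally show "D * l < \<rho>\<^sup>2 / 4" .
  qed
  have front: "q \<in> C" "\<rho> \<le> dist c q" if "q \<in> frontier C" for q
  proof -
    show "q \<in> C" using that closed by (simp add: frontier_def)
    have "ball c \<rho> \<subseteq> interior C" using \<rho>(2) by (intro interior_maximal) auto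
    then show "\<rho> \<le> dist c q" using that unfolding frontier_def by (meson DiffD2 mem_ball not_le subsetD)
  qed
  have "\<forall>p\<in>frontier C. \<exists>r>0. r \<le> \<rho> / 4 \<and> (\<forall>q\<in>C. dist p q \<ge> l \<longrightarrow> q - p \<in> feasible C p r)"
    using feasible_chords[OF C(1,2) \<rho>(2,1) _ l(1), of _ "\<rho> / 4"] front(1) \<rho>(1) by simp
  then obtain r where r: "\<And>p. p \<in> frontier C \<Longrightarrow> 0 < r p" "\<And>p. p \<in> frontier C \<Longrightarrow> r p \<le> \<rho> / 4"
    "\<And>p q. p \<in> frontier C \<Longrightarrow> q \<in> C \<Longrightarrow> l \<le> dist p q \<Longrightarrow> q - p \<in> feasible C p (r p)"
    by metis
  have "frontier C \<subseteq> (\<Union>j\<in>frontier C. ball j (r j / 2))" using r(1) by force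
  then obtain J where J: "J \<subseteq> frontier C" "finite J" "frontier C \<subseteq> (\<Union>j\<in>J. ball j (r j / 2))"
    by (rule compactE_image[OF compact_frontier[OF C(2)] open_ball])
  \<comment> \<open>A cell of side \<open>h\<close> has diameter below \<open>2 * h\<close>, whence
    the quarter of \<open>r j\<close>; the entry 1 keeps the minimum defined for an empty
    \<open>J\<close>.\<close>
  define h where "h = Min (insert 1 ((\<lambda>j. r j / 4) ` J))"
  have fin: "finite (insert 1 ((\<lambda>j. r j / 4) ` J))" using J(2) by simp
  have h: "h > 0" "\<And>j. j \<in> J \<Longrightarrow> 2 * h \<le> r j / 2"
  proof -
    show "h > 0" using r(1) J(1) fin by (auto simp: h_def)
    show "2 * h \<le> r j / 2" if "j \<in> J" for j
      using Min_le[OF fin, of "r j / 4"] that unfolding h_def by simp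
  qed
  have ts: "two_sided (\<lambda>j. local_translates C j (r j) Q) J i R"
    if "i \<in> J" "R \<subseteq> Q" "\<forall>x\<in>R. \<forall>y\<in>R. x \<noteq> y \<longrightarrow> \<not> below (local_translates C i (r i) Q) x y" for i Q R
  proof -
    interpret germs C c \<rho> D l J "\<lambda>j. j" r Q
    proof
      fix j assume "j \<in> J"
      then have j: "j \<in> frontier C" using J(1) by blast
      show "j \<in> C" "\<rho> \<le> dist c j" "0 < r j" "r j \<le> \<rho> / 4" using front[OF j] r(1,2)[OF j] .
      show "dist c j \<le> D" by (rule D(2)[OF front(1)[OF j]])
      show "q - j \<in> feasible C j (r j)" if "q \<in> C" "l \<le> dist j q" for q using r(3)[OF j that] .
    qed (fact C(1) closed \<rho>(2,1) l)+
    show ?thesis using two_sided_antichain[of i R] that by simp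
  qed
  have all_ts: "\<forall>Q. \<forall>i\<in>J. \<forall>R\<subseteq>Q. (\<forall>x\<in>R. \<forall>y\<in>R. x \<noteq> y \<longrightarrow> \<not> below (local_translates C i (r i) Q) x y) \<longrightarrow>
       two_sided (\<lambda>j. local_translates C j (r j) Q) J i R"
    by (intro allI ballI impI) (rule ts)
  show ?thesis
    by (rule exI[of _ J], rule exI[of _ r], rule exI[of _ D0], rule exI[of _ h])
      (intro conjI all_ts J(2,3) h(1), use h(2) in blast, use D0 in blast)
qed

theorem theorem1p1:
  fixes C :: "(real ^ 2) set"
  assumes "convex_body C"
  shows "\<exists>m::nat. m > 0 \<and>
    (\<forall>P :: (real ^ 2) set. finite P \<longrightarrow>
      (\<exists>col :: real ^ 2 \<Rightarrow> nat. col ` P \<subseteq> {..<3} \<and>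
        (\<forall>C'. is_translate_of C' C \<and> card (C' \<inter> P) \<ge> m \<longrightarrow>
          (\<exists>p \<in> C' \<inter> P. \<exists>q \<in> C' \<inter> P. col p \<noteq> col q))))"
proof -
  obtain J :: "(real^2) set" and r D h where h: "h > 0" and J: "finite J"
    and cover: "frontier C \<subseteq> (\<Union>j\<in>J. ball j (r j / 2))" "\<forall>j\<in>J. 2 * h \<le> r j / 2" and D: "\<forall>x\<in>C. norm x \<le> D"
    and ts: "\<forall>Q. \<forall>i\<in>J. \<forall>R\<subseteq>Q. (\<forall>x\<in>R. \<forall>y\<in>R. x \<noteq> y \<longrightarrow> \<not> below (local_translates C i (r i) Q) x y) \<longrightarrow>
       two_sided (\<lambda>j. local_translates C j (r j) Q) J i R"
    using body_local_structure[OF assms] by (elim exE conjE)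
  obtain M where M: "\<forall>(V::(real^2) set) F. finite V \<longrightarrow>
     (\<forall>i\<in>J. \<forall>R\<subseteq>V. (\<forall>x\<in>R. \<forall>y\<in>R. x \<noteq> y \<longrightarrow> \<not> below (F i) x y) \<longrightarrow> two_sided F J i R) \<longrightarrow>
     (\<exists>c::real^2 \<Rightarrow> nat. (\<forall>x. c x < 3) \<and> (\<forall>j\<in>J. \<forall>X\<in>F j. card (X \<inter> V) > M \<longrightarrow> bichromatic c (X \<inter> V)))"
    by (rule exE[OF layered_colouring[OF J]])
  \<comment> \<open>The threshold is \<open>M + 1\<close> rather than \<open>M\<close> so that a
    cell covered by the translate has more than one point even if \<open>M\<close> is 0.\<close>
  have cell: "\<exists>c::real^2 \<Rightarrow> nat. (\<forall>x. c x < 3) \<and>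
      (\<forall>v. card ((\<lambda>x. x + v) ` C \<inter> (P \<inter> grid_cell h k)) > M + 1 \<longrightarrow> bichromatic c ((\<lambda>x. x + v) ` C \<inter> (P \<inter> grid_cell h k)))"
    if fin: "finite P" for P k
  proof -
    define Q where "Q = grid_cell h k"
    define V where "V = P \<inter> Q"
    have finV: "finite V" using fin by (simp add: V_def)
    have tsV: "\<forall>i\<in>J. \<forall>R\<subseteq>V. (\<forall>x\<in>R. \<forall>y\<in>R. x \<noteq> y \<longrightarrow> \<not> below (local_translates C i (r i) Q) x y) \<longrightarrow>
        two_sided (\<lambda>j. local_translates C j (r j) Q) J i R"
      using spec[OF ts, of Q] unfolding V_def by (meson inf.boundedE)
    obtain c0 :: "real^2 \<Rightarrow> nat" where c0: "\<forall>x. c0 x < 3"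
      "\<forall>j\<in>J. \<forall>X\<in>local_translates C j (r j) Q. card (X \<inter> V) > M \<longrightarrow> bichromatic c0 (X \<inter> V)"
      using M[THEN spec, THEN spec, THEN mp, THEN mp, OF finV tsV] by (elim exE conjE)
    obtain c :: "real^2 \<Rightarrow> nat" where c: "\<forall>x. c x < 3"
      "\<forall>X\<in>(\<Union>j\<in>J. local_translates C j (r j) Q). card (X \<inter> V) > M \<longrightarrow> bichromatic c (X \<inter> V)"
      "card V > 1 \<longrightarrow> bichromatic c V"
      using nonconstant_colouring[of c0 "\<Union>j\<in>J. local_translates C j (r j) Q" M V] c0 by blast
    have "bichromatic c ((\<lambda>x. x + v) ` C \<inter> V)" if big: "card ((\<lambda>x. x + v) ` C \<inter> V) > M + 1" for v
    proof (cases "Q \<subseteq> (\<lambda>x. x + v) ` C")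
      case True
      then have "(\<lambda>x. x + v) ` C \<inter> V = V" by (auto simp: V_def)
      then show ?thesis using c(3) big by simp
    next
      case False
      have "(\<lambda>x. x + v) ` C \<inter> V \<noteq> {}" using big by auto
      then have "Q \<inter> (\<lambda>x. x + v) ` C \<noteq> {}" by (auto simp: V_def)
      then obtain j where "j \<in> J" "(\<lambda>x. x + v) ` C \<in> local_translates C j (r j) Q"
        using local_translate_exists[of Q "2 * h" v C "\<lambda>j. j" r J] convex_grid_cell[OF h] dist_grid_cell[OF h] False cover
        unfolding Q_def by blast
      then show ?thesis using c(2) big by auto
    qed
    then show ?thesis using c(1) unfolding V_def Q_def by blast
  qed
  \<comment> \<open>A translate meets at most \<open>n * n\<close> cells; one point more than
    \<open>M + 1\<close> for each of them forces more than \<open>M + 1\<close> into a single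
    cell.\<close>
  define n where "n = nat (\<lceil>2 * D / h\<rceil> + 1)"
  show ?thesis
  proof (intro exI[of _ "n * n * (M + 1) + 1"] conjI allI impI)
    fix P :: "(real^2) set" assume fin: "finite P"
    obtain c :: "int \<times> int \<Rightarrow> real^2 \<Rightarrow> nat" where c: "\<And>k x. c k x < 3"
      "\<And>k v. card ((\<lambda>x. x + v) ` C \<inter> (P \<inter> grid_cell h k)) > M + 1 \<Longrightarrow>
        bichromatic (c k) ((\<lambda>x. x + v) ` C \<inter> (P \<inter> grid_cell h k))"
      using cell[OF fin] by metis
    \<comment> \<open>The colourings of the cells are glued without any compatibility, as two
      colours inside one cell suffice.\<close>
    define col where "col z = c (grid_index h z) z" for z
    have "bichromatic col (C' \<inter> P)" if C': "is_translate_of C' C" and big: "card (C' \<inter> P) \<ge> n * n * (M + 1) + 1" for C'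
    proof -
      obtain v where v: "C' = (\<lambda>x. x + v) ` C" using C' unfolding is_translate_of_def by blast
      define I where "I = grid_range h D (v $ 1) \<times> grid_range h D (v $ 2)"
      have I: "finite I" "card I \<le> n * n"
        unfolding I_def n_def card_cartesian_product using card_grid_range
        by (auto simp: grid_range_def intro!: mult_mono)
      have "grid_index h z \<in> I" if "z \<in> C'" for z
      proof -
        have "z - v \<in> C" using that v by (simp add: mem_translate)
        then have "norm (z - v) \<le> D" by (rule D[rule_format])
        then have "\<bar>z $ i - v $ i\<bar> \<le> D" for i
          using component_le_norm_cart[of "z - v" i] by simp
        then show ?thesis using grid_range_mem[OF h] unfolding I_def grid_index_def by auto
      qed
      then have sub: "C' \<inter> P \<subseteq> (\<Union>k\<in>I. C' \<inter> (P \<inter> grid_cell h k))" by (auto simp: grid_cell_def)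
      have "\<exists>k\<in>I. card (C' \<inter> (P \<inter> grid_cell h k)) > M + 1"
      proof (rule ccontr)
        assume "\<not> ?thesis"
        then have small: "card (C' \<inter> (P \<inter> grid_cell h k)) \<le> M + 1" if "k \<in> I" for k
          using that by (meson not_le)
        have "card (C' \<inter> P) \<le> card (\<Union>k\<in>I. C' \<inter> (P \<inter> grid_cell h k))"
          using sub I(1) fin by (intro card_mono) auto
        also have "\<dots> \<le> (\<Sum>k\<in>I. card (C' \<inter> (P \<inter> grid_cell h k)))" using I(1) by (rule card_UN_le)
        also have "\<dots> \<le> card I * (M + 1)"
          using sum_bounded_above[of I "\<lambda>k. card (C' \<inter> (P \<inter> grid_cell h k))" "M + 1"] small by simp
        also have "\<dots> \<le> n * n * (M + 1)" using I(2) by (intro mult_right_mono) auto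
        finally show False using big by linarith
      qed
      then obtain k where "card (C' \<inter> (P \<inter> grid_cell h k)) > M + 1" by blast
      then have "bichromatic (c k) (C' \<inter> (P \<inter> grid_cell h k))" using c(2)[of v k] v by simp
      moreover have "bichromatic col (C' \<inter> (P \<inter> grid_cell h k)) = bichromatic (c k) (C' \<inter> (P \<inter> grid_cell h k))"
        by (rule bichromatic_cong) (auto simp: col_def grid_cell_def)
      ultimately have "bichromatic col (C' \<inter> (P \<inter> grid_cell h k))" by simp
      then show ?thesis by (rule bichromatic_mono) auto
    qed
    moreover have "col ` P \<subseteq> {..<3}"
      by (intro image_subsetI) (simp only: col_def lessThan_iff c(1))
    ultimately show "\<exists>col :: real ^ 2 \<Rightarrow> nat. col ` P \<subseteq> {..<3} \<and>
        (\<forall>C'. is_translate_of C' C \<and> card (C' \<inter> P) \<ge> n * n * (M + 1) + 1 \<longrightarrow>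
          (\<exists>p \<in> C' \<inter> P. \<exists>q \<in> C' \<inter> P. col p \<noteq> col q))"
      unfolding bichromatic_def by blast
  qed simp
qed

end
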